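(* There exists a constant $\theta>0$ associated with every polynomial pair $(\hat p,\hat q)\in\mathcal{P}_{m,n}$ possessing an exact GCD of degree $k$ such that, for every $(p,q)\in\mathcal{P}_{m,n}$ that is sufficiently close to $(\hat p,\hat q)$, there exists a numerical GCD of $(p,q)$ within every $\varepsilon\in(0,\theta)$. This numerical GCD is unique and is of the same degree $k$. Moreover, $$\lim_{(p,q)\to(\hat p,\hat q)} \gcd\nolimits_\varepsilon(p,q)=\gcd(\hat p,\hat q).$$ When $(p,q)=(\hat p,\hat q)$ in particular, the numerical GCD of $(p,q)$ within $\varepsilon\in(0,\theta)$ is identical to the exact GCD of $(\hat p,\hat q)$.
   Context: All polynomials are in $\mathbb{C}[x]$, one variable. $P_n$ is the vector space of polynomials of degree at most $n$; $\|p\|$ is the Euclidean norm of the coefficient vector of $p$. $P_{m,n}=P_m\times P_n$ with $\|(p,q)\|=\sqrt{\|p\|^2+\|q\|^2}$; closeness of pairs is measured in this norm. $\mathcal{P}_{m,n}=\{(p,q)\in P_{m,n} : \deg p=m,\ \deg q=n\}$. A GCD of $(p,q)$ is any polynomial of highest degree dividing both (not necessarily monic); $\gcd(p,q)$ denotes the set of all GCDs of $(p,q)$, which is one equivalence class for the relation $f\sim g\iff f=\alpha g$ for some constant $\alpha\neq 0$. For $0\le k\le\min\{m,n\}$, $\mathcal{P}^k_{m,n}=\{(p,q)\in\mathcal{P}_{m,n} : \deg\gcd(p,q)=k\}$ and $\theta_k(p,q)=\inf\{\|(p,q)-(r,s)\| : (r,s)\in\mathcal{P}^k_{m,n}\}$.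 Numerical GCD: let $(p,q)\in\mathcal{P}_{m,n}$ and $\varepsilon>0$, and let $k=\max\{j : \theta_j(p,q)<\varepsilon\}$. A numerical GCD of $(p,q)$ within $\varepsilon$ is an exact GCD of a pair $(\tilde p,\tilde q)\in\mathcal{P}^k_{m,n}$ with $\|(\tilde p,\tilde q)-(p,q)\|=\theta_k(p,q)$. The $\sim$-equivalence class of all numerical GCDs of $(p,q)$ within $\varepsilon$ is denoted $\gcd_\varepsilon(p,q)$, so $\gcd_\varepsilon(p,q)=\gcd(\tilde p,\tilde q)$. Uniqueness means uniqueness of this $\sim$-class, and the limit is a limit of $\sim$-classes: for $\hat u\in\gcd(\hat p,\hat q)$ one can choose representatives $u\in\gcd_\varepsilon(p,q)$ with $u\to\hat u$.
   Formalization: For uniqueness and degree k, how close (p,q) must be may depend on ε (existence is uniform in ε): with closeness fixed before ε the claim fails, e.g. (x,x+η) near (x,x) has a numerical GCD of degree 0 once ε ≤ θ_1(x,x+η). *)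

theory Defs
  imports "HOL-Analysis.Analysis" "HOL-Computational_Algebra.Polynomial"
begin

definition poly_norm :: "complex poly \<Rightarrow> real" where
  "poly_norm p = sqrt (\<Sum>i\<le>degree p. (cmod (coeff p i))\<^sup>2)"

definition pair_norm :: "complex poly \<times> complex poly \<Rightarrow> real" where
  "pair_norm x = sqrt ((poly_norm (fst x))\<^sup>2 + (poly_norm (snd x))\<^sup>2)"

(* The zero polynomial has no degree as a natural number in the mathematics, but degree 0
   in the library; the conjuncts fst x \<noteq> 0 and snd x \<noteq> 0 matter only when m = 0 or n = 0. *)
definition deg_pairs :: "nat \<Rightarrow> nat \<Rightarrow> (complex poly \<times> complex poly) set" where
  "deg_pairs m n = {x. fst x \<noteq> 0 \<and> snd x \<noteq> 0 \<and> degree (fst x) = m \<and> degree (snd x) = n}"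

(* All common divisors of highest degree, not only the normalised one that gcd picks. *)
definition exact_gcds :: "complex poly \<times> complex poly \<Rightarrow> complex poly set" where
  "exact_gcds x = {u. u dvd fst x \<and> u dvd snd x \<and>
     (\<forall>d. d dvd fst x \<longrightarrow> d dvd snd x \<longrightarrow> degree d \<le> degree u)}"

definition poly_sim :: "complex poly \<Rightarrow> complex poly \<Rightarrow> bool" where
  "poly_sim f g \<longleftrightarrow> (\<exists>\<alpha>. \<alpha> \<noteq> 0 \<and> f = smult \<alpha> g)"

(* By maximality, all elements of exact_gcds x have the same degree. *)
definition gcd_deg_pairs :: "nat \<Rightarrow> nat \<Rightarrow> nat \<Rightarrow> (complex poly \<times> complex poly) set" where
  "gcd_deg_pairs m n k = {x \<in> deg_pairs m n. \<exists>u \<in> exact_gcds x. degree u = k}"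

(* Meaningful for k \<le> min m n, where the set of distances is nonempty and bounded below. *)
definition gcd_dist :: "nat \<Rightarrow> nat \<Rightarrow> nat \<Rightarrow> complex poly \<times> complex poly \<Rightarrow> real" where
  "gcd_dist m n k x = Inf {pair_norm (x - y) | y. y \<in> gcd_deg_pairs m n k}"

(* The bound j \<le> min m n makes the set finite and keeps out the infimum of the empty set.
   The set contains 0 whenever x is in deg_pairs m n and \<epsilon> > 0, since coprime pairs are dense. *)
definition num_gcd_degree :: "nat \<Rightarrow> nat \<Rightarrow> real \<Rightarrow> complex poly \<times> complex poly \<Rightarrow> nat" where
  "num_gcd_degree m n \<epsilon> x = Max {j. j \<le> min m n \<and> gcd_dist m n j x < \<epsilon>}"

(* Exact GCDs of all nearest pairs; nothing is said here about existence of a nearest pair,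
   nor about different nearest pairs having the same GCDs. *)
definition num_gcds :: "nat \<Rightarrow> nat \<Rightarrow> real \<Rightarrow> complex poly \<times> complex poly \<Rightarrow> complex poly set" where
  "num_gcds m n \<epsilon> x = {u. \<exists>y \<in> gcd_deg_pairs m n (num_gcd_degree m n \<epsilon> x).
     pair_norm (y - x) = gcd_dist m n (num_gcd_degree m n \<epsilon> x) x \<and> u \<in> exact_gcds y}"

(* Limit of classes of polynomials as x in A tends to a: every element of the limit class L
   is the limit of some choice of representatives of the classes G x. *)
definition class_limit ::
  "(complex poly \<times> complex poly) set \<Rightarrow> (complex poly \<times> complex poly \<Rightarrow> complex poly set) \<Rightarrow>
   complex poly \<times> complex poly \<Rightarrow> complex poly set \<Rightarrow> bool" where
  "class_limit A G a L \<longleftrightarrow> (\<forall>v \<in> L. \<exists>U. \<forall>\<eta>>0. \<exists>\<delta>>0. \<forall>x \<in> A.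
     pair_norm (x - a) < \<delta> \<longrightarrow> U x \<in> G x \<and> poly_norm (U x - v) < \<eta>)"

end

theory Submission
  imports Defs "HOL-Computational_Algebra.Polynomial_Factorial" "HOL-Computational_Algebra.Field_as_Ring"
begin

text \<open>Let \<open>a\<close> have GCD degree \<open>k\<close>. Everything rests on one compactness fact
  (\<open>common_divisor_limit\<close>): if pairs of fixed degrees converge and no degree drops, then their
  monic common divisors of degree \<open>j\<close>, together with the cofactors, accumulate at a monic common
  divisor of degree \<open>j\<close> of the limit and its cofactors. Indeed, polynomials of norm 1 and bounded
  degree have products bounded away from 0, so the factors of a bounded polynomial are bounded
  once neither can be small.

  This has three consequences. First, the GCD degree can only jump up in a limit, so there is a
  ball of some radius \<open>\<delta>\<close> around \<open>a\<close> in which it is at most \<open>k\<close>. For \<open>\<epsilon> \<le> \<delta> / 2\<close> and \<open>x\<close> closer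
  to \<open>a\<close> than \<open>\<epsilon>\<close>, the manifold of GCD degree \<open>k\<close> is closer to \<open>x\<close> than \<open>\<epsilon>\<close> and all manifolds of
  larger GCD degree are not; hence the numerical GCD degree is \<open>k\<close>. Second, a nearest pair exists
  (\<open>nearest_pairs_nonempty\<close>): a minimising sequence accumulates at a pair whose GCD degree is at
  least the numerical one, and a larger one contradicts the maximality that defines the numerical
  GCD degree. The degrees of the pair do not drop because \<open>\<epsilon>\<close> is at most the modulus of the
  leading coefficients of \<open>x\<close>. Third, on pairs of constant GCD degree the monic GCD is continuous
  (\<open>gcd_cofactors_tendsto\<close>), which gives the limit of the GCD classes.

  Uniqueness (\<open>nearest_pair_unique_near\<close>) is where the geometry enters. Near \<open>a\<close> the pairs of GCD
  degree \<open>k\<close> are the image of \<open>(u, v, w) \<mapsto> (u v, u w)\<close> with \<open>u\<close> monic of degree \<open>k\<close>, and the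
  differential of this quadratic map is injective at the factors of \<open>a\<close> because the cofactors are
  coprime. If two different pairs were nearest to \<open>x\<close>, the midpoint of their factors would
  give a competitor that is not closer to \<open>x\<close>, and the parallelogram identity would bound the square
  of the differential along the half difference \<open>h\<close> by a quantity of order \<open>\<bar>h\<bar>\<^sup>2\<close> times the
  distance from the midpoint pair to \<open>x\<close>. Since that distance tends to 0 as \<open>x\<close> tends to \<open>a\<close>,
  the normalised differences would have a limit in the kernel of the differential.\<close>

section \<open>The Euclidean norm of polynomials and of pairs\<close>

lemma poly_norm_eq_L2_set:
  assumes "degree p \<le> N"
  shows "poly_norm p = L2_set (\<lambda>i. cmod (coeff p i)) {..N}"
proof -
  have "(\<Sum>i\<le>degree p. (cmod (coeff p i))\<^sup>2) = (\<Sum>i\<le>N. (cmod (coeff p i))\<^sup>2)"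
    using assms by (intro sum.mono_neutral_left) (auto simp: coeff_eq_0)
  then show ?thesis
    by (simp add: poly_norm_def L2_set_def)
qed

lemma poly_norm_power2:
  assumes "degree p \<le> N"
  shows "(poly_norm p)\<^sup>2 = (\<Sum>i\<le>N. (cmod (coeff p i))\<^sup>2)"
  using poly_norm_eq_L2_set[OF assms] by (simp add: L2_set_def sum_nonneg)

lemma poly_norm_nonneg [simp]: "0 \<le> poly_norm p"
  by (simp add: poly_norm_def sum_nonneg)

lemma cmod_coeff_le_poly_norm: "cmod (coeff p j) \<le> poly_norm p"
proof (cases "j \<le> degree p")
  case True
  then show ?thesis
    unfolding poly_norm_eq_L2_set[OF order_refl] by (intro member_le_L2_set) auto
qed (simp add: coeff_eq_0)

lemma poly_norm_eq_0_iff [simp]: "poly_norm p = 0 \<longleftrightarrow> p = 0"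
proof
  assume "poly_norm p = 0"
  then have "coeff p j = 0" for j
    using cmod_coeff_le_poly_norm[of p j] by simp
  then show "p = 0" by (simp add: poly_eqI)
qed (simp add: poly_norm_def)

lemma poly_norm_0 [simp]: "poly_norm 0 = 0"
  by (simp add: poly_norm_def)

lemma poly_norm_smult: "poly_norm (smult c p) = cmod c * poly_norm p"
  using poly_norm_eq_L2_set[OF degree_smult_le, of c p] poly_norm_eq_L2_set[of p "degree p"]
  by (simp add: L2_set_right_distrib norm_mult)

lemma poly_norm_minus [simp]: "poly_norm (- p) = poly_norm p"
  using poly_norm_smult[of "-1" p] by simp

lemma poly_norm_triangle: "poly_norm (p + q) \<le> poly_norm p + poly_norm q"
proof -
  define N where "N = max (degree p) (degree q)"
  have deg: "degree p \<le> N" "degree q \<le> N" "degree (p + q) \<le> N"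
    by (auto simp: N_def intro: degree_add_le_max)
  have "L2_set (\<lambda>i. cmod (coeff (p + q) i)) {..N}
      \<le> L2_set (\<lambda>i. cmod (coeff p i) + cmod (coeff q i)) {..N}"
    by (intro L2_set_mono) (auto intro: norm_triangle_ineq)
  also have "\<dots> \<le> L2_set (\<lambda>i. cmod (coeff p i)) {..N} + L2_set (\<lambda>i. cmod (coeff q i)) {..N}"
    by (rule L2_set_triangle_ineq)
  finally show ?thesis
    using deg by (simp add: poly_norm_eq_L2_set)
qed

lemma poly_norm_parallelogram:
  "(poly_norm (p + q))\<^sup>2 + (poly_norm (p - q))\<^sup>2 = 2 * (poly_norm p)\<^sup>2 + 2 * (poly_norm q)\<^sup>2"
proof -
  define N where "N = max (degree p) (degree q)"
  have deg: "degree p \<le> N" "degree q \<le> N" "degree (p + q) \<le> N" "degree (p - q) \<le> N"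
    by (auto simp: N_def intro: degree_add_le_max degree_diff_le_max)
  have "(cmod (z + w))\<^sup>2 + (cmod (z - w))\<^sup>2 = 2 * (cmod z)\<^sup>2 + 2 * (cmod w)\<^sup>2" for z w
    unfolding cmod_power2 by (simp add: power2_eq_square algebra_simps)
  then show ?thesis
    using deg by (simp add: poly_norm_power2 sum_distrib_left flip: sum.distrib)
qed

lemma pair_norm_power2: "(pair_norm x)\<^sup>2 = (poly_norm (fst x))\<^sup>2 + (poly_norm (snd x))\<^sup>2"
  by (simp add: pair_norm_def)

lemma pair_norm_nonneg [simp]: "0 \<le> pair_norm x"
  by (simp add: pair_norm_def)

lemma poly_norm_le_pair_norm:
  "poly_norm (fst x) \<le> pair_norm x" "poly_norm (snd x) \<le> pair_norm x"
  by (simp_all add: pair_norm_def real_le_rsqrt)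

lemma pair_norm_eq_0_iff [simp]: "pair_norm x = 0 \<longleftrightarrow> x = 0"
  by (simp add: pair_norm_def prod_eq_iff sum_power2_eq_zero_iff)

lemma pair_norm_0 [simp]: "pair_norm 0 = 0"
  by (simp add: pair_norm_def)

lemma pair_norm_minus_commute: "pair_norm (x - y) = pair_norm (y - x)"
  using poly_norm_minus[of "fst x - fst y"] poly_norm_minus[of "snd x - snd y"]
  by (simp add: pair_norm_def)

lemma pair_norm_triangle: "pair_norm (x + y) \<le> pair_norm x + pair_norm y"
proof -
  have "pair_norm (x + y) \<le> sqrt ((poly_norm (fst x) + poly_norm (fst y))\<^sup>2
      + (poly_norm (snd x) + poly_norm (snd y))\<^sup>2)"
    unfolding pair_norm_def
    by (intro real_sqrt_le_mono add_mono power_mono) (auto intro: poly_norm_triangle)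
  also have "\<dots> \<le> pair_norm x + pair_norm y"
    unfolding pair_norm_def by (rule real_sqrt_sum_squares_triangle_ineq)
  finally show ?thesis .
qed

lemma pair_norm_diff_triangle: "pair_norm (x - z) \<le> pair_norm (x - y) + pair_norm (y - z)"
  using pair_norm_triangle[of "x - y" "y - z"] by simp

lemma pair_norm_parallelogram:
  "(pair_norm (x + y))\<^sup>2 + (pair_norm (x - y))\<^sup>2 = 2 * (pair_norm x)\<^sup>2 + 2 * (pair_norm y)\<^sup>2"
  using poly_norm_parallelogram[of "fst x" "fst y"] poly_norm_parallelogram[of "snd x" "snd y"]
  by (simp add: pair_norm_power2)

lemma pair_norm_smult: "pair_norm (smult c p, smult c q) = cmod c * pair_norm (p, q)"
proof (rule power2_eq_imp_eq)
  show "(pair_norm (smult c p, smult c q))\<^sup>2 = (cmod c * pair_norm (p, q))\<^sup>2"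
    by (simp add: pair_norm_power2 poly_norm_smult power_mult_distrib algebra_simps)
qed auto


section \<open>Coefficientwise convergence and compactness\<close>

text \<open>On polynomials of bounded degree this is convergence in the norm. Without the degree bound
  it is still compatible with sums and products, because each coefficient of a product
  is a finite sum of products of coefficients.\<close>

definition coeffs_tendsto :: "(nat \<Rightarrow> complex poly) \<Rightarrow> complex poly \<Rightarrow> bool" where
  "coeffs_tendsto P p \<longleftrightarrow> (\<forall>j. (\<lambda>i. coeff (P i) j) \<longlonglongrightarrow> coeff p j)"

lemma coeffs_tendsto_const: "coeffs_tendsto (\<lambda>_. p) p"
  by (simp add: coeffs_tendsto_def)

lemma coeffs_tendsto_add:
  "coeffs_tendsto P p \<Longrightarrow> coeffs_tendsto Q q \<Longrightarrow> coeffs_tendsto (\<lambda>i. P i + Q i) (p + q)"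
  by (auto simp: coeffs_tendsto_def intro: tendsto_add)

lemma coeffs_tendsto_diff:
  "coeffs_tendsto P p \<Longrightarrow> coeffs_tendsto Q q \<Longrightarrow> coeffs_tendsto (\<lambda>i. P i - Q i) (p - q)"
  by (auto simp: coeffs_tendsto_def intro: tendsto_diff)

lemma coeffs_tendsto_smult: "coeffs_tendsto P p \<Longrightarrow> coeffs_tendsto (\<lambda>i. smult c (P i)) (smult c p)"
  by (auto simp: coeffs_tendsto_def intro: tendsto_mult_left)

lemma coeffs_tendsto_mult:
  "coeffs_tendsto P p \<Longrightarrow> coeffs_tendsto Q q \<Longrightarrow> coeffs_tendsto (\<lambda>i. P i * Q i) (p * q)"
  by (auto simp: coeffs_tendsto_def coeff_mult intro!: tendsto_sum tendsto_mult)

lemma coeffs_tendsto_subseq: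
  "coeffs_tendsto P p \<Longrightarrow> strict_mono r \<Longrightarrow> coeffs_tendsto (\<lambda>i. P (r i)) p"
  using LIMSEQ_subseq_LIMSEQ by (fastforce simp: coeffs_tendsto_def o_def)

lemma coeffs_tendsto_unique: "coeffs_tendsto P p \<Longrightarrow> coeffs_tendsto P q \<Longrightarrow> p = q"
  unfolding coeffs_tendsto_def by (blast intro: poly_eqI LIMSEQ_unique)

lemma degree_coeffs_limit_le:
  assumes "coeffs_tendsto P p" "\<And>i. degree (P i) \<le> N"
  shows "degree p \<le> N"
proof (rule degree_le, intro allI impI)
  fix j assume "N < j"
  then have "coeff (P i) j = 0" for i
    using assms(2)[of i] by (auto intro: coeff_eq_0)
  then show "coeff p j = 0"
    using assms(1) by (auto simp: coeffs_tendsto_def LIMSEQ_const_iff dest!: spec[of _ j])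
qed

lemma tendsto_poly_norm:
  assumes "coeffs_tendsto P p" "\<And>i. degree (P i) \<le> N"
  shows "(\<lambda>i. poly_norm (P i)) \<longlonglongrightarrow> poly_norm p"
proof -
  have "(\<lambda>i. L2_set (\<lambda>j. cmod (coeff (P i) j)) {..N}) \<longlonglongrightarrow> L2_set (\<lambda>j. cmod (coeff p j)) {..N}"
    unfolding L2_set_def
    using assms(1) by (auto simp: coeffs_tendsto_def intro!: tendsto_intros)
  then show ?thesis
    using degree_coeffs_limit_le[OF assms] assms(2) by (simp add: poly_norm_eq_L2_set[where N = N])
qed

lemma tendsto_pair_norm:
  assumes "coeffs_tendsto (\<lambda>i. fst (X i)) (fst x)" "coeffs_tendsto (\<lambda>i. snd (X i)) (snd x)"
    and "\<And>i. degree (fst (X i)) \<le> N" "\<And>i. degree (snd (X i)) \<le> N"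
  shows "(\<lambda>i. pair_norm (X i)) \<longlonglongrightarrow> pair_norm x"
  unfolding pair_norm_def
  using tendsto_poly_norm[OF assms(1,3)] tendsto_poly_norm[OF assms(2,4)]
  by (intro tendsto_intros)

lemma coeffs_tendsto_of_pair_norm:
  assumes "(\<lambda>i. pair_norm (X i - a)) \<longlonglongrightarrow> 0"
  shows "coeffs_tendsto (\<lambda>i. fst (X i)) (fst a)" "coeffs_tendsto (\<lambda>i. snd (X i)) (snd a)"
proof -
  have "cmod (coeff (fst (X i)) j - coeff (fst a) j) \<le> pair_norm (X i - a)"
    and "cmod (coeff (snd (X i)) j - coeff (snd a) j) \<le> pair_norm (X i - a)" for i j
    using cmod_coeff_le_poly_norm[of "fst (X i - a)" j] poly_norm_le_pair_norm(1)[of "X i - a"]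
      cmod_coeff_le_poly_norm[of "snd (X i - a)" j] poly_norm_le_pair_norm(2)[of "X i - a"]
    by simp_all
  then have "(\<lambda>i. coeff (fst (X i)) j - coeff (fst a) j) \<longlonglongrightarrow> 0"
       "(\<lambda>i. coeff (snd (X i)) j - coeff (snd a) j) \<longlonglongrightarrow> 0" for j
    by (auto intro!: tendsto_0_le[OF assms, where K = 1])
  then show "coeffs_tendsto (\<lambda>i. fst (X i)) (fst a)" "coeffs_tendsto (\<lambda>i. snd (X i)) (snd a)"
    by (simp_all add: coeffs_tendsto_def LIM_zero_iff)
qed

lemma bounded_coordinates_subseq:
  fixes f :: "nat \<Rightarrow> nat \<Rightarrow> complex"
  assumes "\<And>i j. j < N \<Longrightarrow> cmod (f i j) \<le> B"
  shows "\<exists>r l. strict_mono r \<and> (\<forall>j<N. (\<lambda>i. f (r i) j) \<longlonglongrightarrow> l j)"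
  using assms
proof (induction N)
  case 0
  then show ?case by (auto intro: exI[of _ id] strict_mono_id)
next
  case (Suc N)
  then obtain r l where r: "strict_mono r" and l: "\<And>j. j < N \<Longrightarrow> (\<lambda>i. f (r i) j) \<longlonglongrightarrow> l j"
    by (metis less_Suc_eq)
  have "bounded (range (\<lambda>i. f (r i) N))"
    using Suc.prems by (auto simp: bounded_iff)
  then obtain l' s where s: "strict_mono s" and l': "((\<lambda>i. f (r i) N) \<circ> s) \<longlonglongrightarrow> l'"
    by (blast dest: bounded_imp_convergent_subsequence)
  have "(\<lambda>i. f ((r \<circ> s) i) j) \<longlonglongrightarrow> (l(N := l')) j" if "j < Suc N" for j
    using that l' LIMSEQ_subseq_LIMSEQ[OF l s, of j] by (auto simp: o_def less_Suc_eq)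
  then show ?case
    using strict_mono_o[OF r s] by blast
qed

lemma bounded_polys_subseq:
  fixes P :: "nat \<Rightarrow> complex poly"
  assumes "\<And>i. degree (P i) \<le> N" "\<And>i. poly_norm (P i) \<le> B"
  obtains r p where "strict_mono r" "coeffs_tendsto (\<lambda>i. P (r i)) p"
proof -
  obtain r l where r: "strict_mono r" and l: "\<And>j. j < Suc N \<Longrightarrow> (\<lambda>i. coeff (P (r i)) j) \<longlonglongrightarrow> l j"
    using bounded_coordinates_subseq[of "Suc N" "\<lambda>i. coeff (P i)" B]
      order_trans[OF cmod_coeff_le_poly_norm assms(2)] by metis
  define p where "p = (\<Sum>j\<le>N. monom (l j) j)"
  have "coeff p j = (if j \<le> N then l j else 0)" for j
    by (simp add: p_def coeff_sum sum.delta)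
  moreover have "coeff (P i) j = 0" if "\<not> j \<le> N" for i j
    using that assms(1)[of i] by (intro coeff_eq_0) auto
  ultimately have "coeffs_tendsto (\<lambda>i. P (r i)) p"
    using l by (auto simp: coeffs_tendsto_def less_Suc_eq_le)
  with r show ?thesis by (rule that)
qed

lemma bounded_poly_triples_subseq:
  fixes P Q R :: "nat \<Rightarrow> complex poly"
  assumes "\<And>i. degree (P i) \<le> N" "\<And>i. degree (Q i) \<le> N" "\<And>i. degree (R i) \<le> N"
    and "\<And>i. poly_norm (P i) \<le> B" "\<And>i. poly_norm (Q i) \<le> B" "\<And>i. poly_norm (R i) \<le> B"
  obtains s p q t where "strict_mono s" "coeffs_tendsto (\<lambda>i. P (s i)) p"
    "coeffs_tendsto (\<lambda>i. Q (s i)) q" "coeffs_tendsto (\<lambda>i. R (s i)) t"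
proof -
  obtain r1 p where 1: "strict_mono r1" "coeffs_tendsto (\<lambda>i. P (r1 i)) p"
    using bounded_polys_subseq[of P N B] assms by metis
  obtain r2 q where 2: "strict_mono r2" "coeffs_tendsto (\<lambda>i. Q (r1 (r2 i))) q"
    using bounded_polys_subseq[of "\<lambda>i. Q (r1 i)" N B] assms by metis
  obtain r3 t where 3: "strict_mono r3" "coeffs_tendsto (\<lambda>i. R (r1 (r2 (r3 i)))) t"
    using bounded_polys_subseq[of "\<lambda>i. R (r1 (r2 i))" N B] assms by metis
  have "strict_mono (\<lambda>i. r1 (r2 (r3 i)))"
    using strict_mono_o[OF 1(1) strict_mono_o[OF 2(1) 3(1)]] by (simp add: o_def)
  then show ?thesis
  proof (rule that)
    show "coeffs_tendsto (\<lambda>i. P (r1 (r2 (r3 i)))) p"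
      using coeffs_tendsto_subseq[OF coeffs_tendsto_subseq[OF 1(2) 2(1)] 3(1)] .
    show "coeffs_tendsto (\<lambda>i. Q (r1 (r2 (r3 i)))) q"
      using coeffs_tendsto_subseq[OF 2(2) 3(1)] .
    show "coeffs_tendsto (\<lambda>i. R (r1 (r2 (r3 i)))) t"
      by (rule 3(2))
  qed
qed

lemma LIMSEQ_if_subseqs_have_convergent_subseqs:
  fixes f :: "nat \<Rightarrow> 'a::metric_space"
  assumes "\<And>r :: nat \<Rightarrow> nat. strict_mono r \<Longrightarrow>
    \<exists>s :: nat \<Rightarrow> nat. strict_mono s \<and> (\<lambda>i. f (r (s i))) \<longlonglongrightarrow> l"
  shows "f \<longlonglongrightarrow> l"
proof (rule ccontr)
  assume "\<not> f \<longlonglongrightarrow> l"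
  then obtain e where e: "e > 0" "\<exists>\<^sub>F i in sequentially. \<not> dist (f i) l < e"
    by (auto simp: tendsto_iff not_eventually)
  define S where "S = {i. \<not> dist (f i) l < e}"
  have inf: "infinite S"
    using e(2) unfolding S_def frequently_cofinite[symmetric] cofinite_eq_sequentially .
  obtain s where s: "(\<lambda>i. f (enumerate S (s i))) \<longlonglongrightarrow> l"
    using assms[OF strict_mono_enumerate[OF inf]] by auto
  then have "eventually (\<lambda>i. dist (f (enumerate S (s i))) l < e) sequentially"
    using e(1) by (rule tendstoD)
  moreover have "\<not> dist (f (enumerate S (s i))) l < e" for i
    using enumerate_in_set[OF inf, of "s i"] by (simp add: S_def)
  ultimately show False by simp
qed



section \<open>Factors of convergent polynomials\<close>

text \<open>The unit spheres are compact and the ring of polynomials has no zero divisors, so the product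
  of two polynomials of norm 1 and bounded degree stays away from 0.\<close>

lemma poly_norm_mult_ge:
  obtains c where "c > 0"
    "\<And>u v. degree u \<le> N \<Longrightarrow> degree v \<le> N \<Longrightarrow> c * (poly_norm u * poly_norm v) \<le> poly_norm (u * v)"
proof (rule ccontr)
  assume "\<not> thesis"
  then have neg: "\<exists>u v. degree u \<le> N \<and> degree v \<le> N \<and> poly_norm (u * v) < c * (poly_norm u * poly_norm v)"
    if "c > 0" for c
    using that \<open>\<And>c. \<lbrakk>c > 0; \<And>u v. degree u \<le> N \<Longrightarrow> degree v \<le> N \<Longrightarrow>
      c * (poly_norm u * poly_norm v) \<le> poly_norm (u * v)\<rbrakk> \<Longrightarrow> thesis\<close>
    by (meson not_le)
  have "\<exists>u v. degree u \<le> N \<and> degree v \<le> N \<and>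
      poly_norm (u * v) < 1 / real (Suc i) * (poly_norm u * poly_norm v)" for i
    by (rule neg) simp
  then obtain u v where deg: "\<And>i. degree (u i) \<le> N" "\<And>i. degree (v i) \<le> N"
    and less: "\<And>i. poly_norm (u i * v i) < 1 / real (Suc i) * (poly_norm (u i) * poly_norm (v i))"
    by metis
  have nz: "u i \<noteq> 0" "v i \<noteq> 0" for i
    using less[of i] by auto
  then have pos: "poly_norm (u i) > 0" "poly_norm (v i) > 0" for i
    by (simp_all add: less_le)
  define P where "P i = smult (of_real (1 / poly_norm (u i))) (u i)" for i
  define Q where "Q i = smult (of_real (1 / poly_norm (v i))) (v i)" for i
  have norms: "poly_norm (P i) = 1" "poly_norm (Q i) = 1" for i
    using nz[of i] by (simp_all add: P_def Q_def poly_norm_smult norm_divide)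
  have degs: "degree (P i) \<le> N" "degree (Q i) \<le> N" for i
    using deg by (simp_all add: P_def Q_def)
  have small: "poly_norm (P i * Q i) \<le> inverse (real (Suc i))" for i
  proof -
    have "poly_norm (P i * Q i) = poly_norm (u i * v i) / (poly_norm (u i) * poly_norm (v i))"
      by (simp add: P_def Q_def poly_norm_smult norm_mult norm_divide)
    also have "\<dots> \<le> inverse (real (Suc i))"
      using less[of i] pos[of i] by (simp add: field_simps)
    finally show ?thesis .
  qed
  obtain s p q where s: "strict_mono s"
    and p: "coeffs_tendsto (\<lambda>i. P (s i)) p" and q: "coeffs_tendsto (\<lambda>i. Q (s i)) q"
    using bounded_poly_triples_subseq[of P N Q Q 1] degs norms by (metis order_refl)
  have "poly_norm p = 1" "poly_norm q = 1"
    using tendsto_poly_norm[OF p degs(1)] tendsto_poly_norm[OF q degs(2)] norms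
    by (simp_all add: LIMSEQ_const_iff)
  then have "p * q \<noteq> 0"
    by auto
  have "degree (P i * Q i) \<le> N + N" for i
    using degree_mult_le[of "P i" "Q i"] degs[of i] by linarith
  then have "(\<lambda>i. poly_norm (P (s i) * Q (s i))) \<longlonglongrightarrow> poly_norm (p * q)"
    using tendsto_poly_norm[OF coeffs_tendsto_mult[OF p q]] by blast
  moreover have "(\<lambda>i. poly_norm (P (s i) * Q (s i))) \<longlonglongrightarrow> 0"
  proof (rule tendsto_sandwich[of "\<lambda>_. 0" _ _ "\<lambda>i. inverse (real (Suc (s i)))"])
    show "(\<lambda>i. inverse (real (Suc (s i)))) \<longlonglongrightarrow> 0"
      using LIMSEQ_subseq_LIMSEQ[OF LIMSEQ_inverse_real_of_nat s] by (simp add: o_def)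
  qed (use small in auto)
  ultimately have "poly_norm (p * q) = 0"
    by (rule LIMSEQ_unique)
  with \<open>p * q \<noteq> 0\<close> show False by simp
qed

text \<open>A monic factor has norm at least 1, and its cofactor has the leading coefficient of the
  product; so both norms are bounded below and therefore also bounded above.\<close>

lemma monic_factors_bounded:
  assumes "coeffs_tendsto (\<lambda>i. U i * V i) p" "p \<noteq> 0"
    and "\<And>i. degree (U i * V i) = degree p" "\<And>i. lead_coeff (U i) = 1" "\<And>i. V i \<noteq> 0"
  shows "\<exists>B. \<forall>i. poly_norm (U i) \<le> B \<and> poly_norm (V i) \<le> B \<and>
    degree (U i) \<le> degree p \<and> degree (V i) \<le> degree p"
proof -
  have U: "U i \<noteq> 0" for i
    using assms(4)[of i] by auto
  have deg: "degree (U i) \<le> degree p" "degree (V i) \<le> degree p" for i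
    using assms(3)[of i] degree_mult_eq[OF U assms(5), of i i] by simp_all
  obtain c where c: "c > 0" "\<And>u v. degree u \<le> degree p \<Longrightarrow> degree v \<le> degree p \<Longrightarrow>
      c * (poly_norm u * poly_norm v) \<le> poly_norm (u * v)"
    using poly_norm_mult_ge by blast
  have "(\<lambda>i. poly_norm (U i * V i)) \<longlonglongrightarrow> poly_norm p"
    by (rule tendsto_poly_norm[OF assms(1) eq_refl[OF assms(3)]])
  then have "Bseq (\<lambda>i. poly_norm (U i * V i))"
    by (rule convergent_imp_Bseq[OF convergentI])
  then obtain K where K: "K > 0" "\<And>i. poly_norm (U i * V i) \<le> K"
    by (auto simp: Bseq_def)
  have "(\<lambda>i. inverse (coeff (U i * V i) (degree p))) \<longlonglongrightarrow> inverse (lead_coeff p)"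
    using assms(1,2) by (intro tendsto_inverse) (auto simp: coeffs_tendsto_def)
  then have "Bseq (\<lambda>i. inverse (coeff (U i * V i) (degree p)))"
    by (rule convergent_imp_Bseq[OF convergentI])
  then obtain L where L: "L > 0" "\<And>i. cmod (inverse (coeff (U i * V i) (degree p))) \<le> L"
    unfolding Bseq_def by blast
  have lc: "coeff (U i * V i) (degree p) = lead_coeff (V i)" for i
    using lead_coeff_mult[of "U i" "V i"] assms(3)[of i] assms(4)[of i] by simp
  have V_ge: "inverse L \<le> poly_norm (V i)" for i
  proof -
    have "inverse L \<le> inverse (cmod (inverse (lead_coeff (V i))))"
      using L(2)[of i] assms(5)[of i] by (intro le_imp_inverse_le) (auto simp: lc)
    also have "\<dots> = cmod (lead_coeff (V i))"
      by (simp add: norm_inverse)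
    also have "\<dots> \<le> poly_norm (V i)"
      by (rule cmod_coeff_le_poly_norm)
    finally show ?thesis .
  qed
  have U_ge: "1 \<le> poly_norm (U i)" for i
    using cmod_coeff_le_poly_norm[of "U i" "degree (U i)"] assms(4)[of i] by simp
  have prod_le: "poly_norm (U i) * poly_norm (V i) \<le> K / c" for i
    using c(2)[OF deg, of i i] K(2)[of i] c(1) by (simp add: field_simps)
  have "poly_norm (V i) \<le> K / c" for i
    using mult_right_mono[OF U_ge[of i] poly_norm_nonneg[of "V i"]] prod_le[of i] by simp
  moreover have "poly_norm (U i) \<le> K / c * L" for i
  proof -
    have "poly_norm (U i) * inverse L \<le> K / c"
      using mult_left_mono[OF V_ge[of i] poly_norm_nonneg[of "U i"]] prod_le[of i] by linarith
    then show ?thesis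
      using L(1) by (simp add: field_simps)
  qed
  ultimately show ?thesis
    using deg by (intro exI[of _ "max (K / c) (K / c * L)"]) (auto simp: le_max_iff_disj)
qed

text \<open>The factors are bounded, so they have convergent subsequences. A limit of monic polynomials of
  degree \<open>j\<close> whose degrees are exactly \<open>j\<close> is again monic of degree \<open>j\<close>, and limits respect products.
  That the degrees of the pair do not drop is essential: with it the leading coefficients stay
  away from 0, which is what bounds the factors.\<close>

lemma common_divisor_limit:
  assumes X: "\<And>i. (U i * V i, U i * W i) \<in> deg_pairs m n" and a: "a \<in> deg_pairs m n"
    and lim: "coeffs_tendsto (\<lambda>i. U i * V i) (fst a)" "coeffs_tendsto (\<lambda>i. U i * W i) (snd a)"
    and U: "\<And>i. lead_coeff (U i) = 1" "\<And>i. degree (U i) = j"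
  obtains s u v w where "strict_mono s" "coeffs_tendsto (\<lambda>i. U (s i)) u"
    "coeffs_tendsto (\<lambda>i. V (s i)) v" "coeffs_tendsto (\<lambda>i. W (s i)) w"
    "lead_coeff u = 1" "degree u = j" "a = (u * v, u * w)"
proof -
  have nz: "fst a \<noteq> 0" "snd a \<noteq> 0" "V i \<noteq> 0" "W i \<noteq> 0" for i
    using a X[of i] by (auto simp: deg_pairs_def)
  have degs: "degree (U i * V i) = degree (fst a)" "degree (U i * W i) = degree (snd a)" for i
    using a X[of i] by (auto simp: deg_pairs_def)
  obtain B1 where B1: "\<And>i. poly_norm (U i) \<le> B1" "\<And>i. poly_norm (V i) \<le> B1"
    "\<And>i. degree (U i) \<le> degree (fst a)" "\<And>i. degree (V i) \<le> degree (fst a)"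
    using monic_factors_bounded[OF lim(1) nz(1) degs(1) U(1) nz(3)] by metis
  obtain B2 where B2: "\<And>i. poly_norm (W i) \<le> B2" "\<And>i. degree (W i) \<le> degree (snd a)"
    using monic_factors_bounded[OF lim(2) nz(2) degs(2) U(1) nz(4)] by blast
  obtain s u v w where s: "strict_mono s" and u: "coeffs_tendsto (\<lambda>i. U (s i)) u"
    and v: "coeffs_tendsto (\<lambda>i. V (s i)) v" and w: "coeffs_tendsto (\<lambda>i. W (s i)) w"
    using bounded_poly_triples_subseq[of U "max (degree (fst a)) (degree (snd a))" V W "max B1 B2"]
      B1 B2 by (metis le_max_iff_disj)
  have "coeff (U i) j = 1" for i
    using U[of i] by simp
  then have "coeff u j = 1"
    using u by (auto simp: coeffs_tendsto_def LIMSEQ_const_iff dest!: spec[of _ j])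
  moreover from this have "degree u = j"
    using degree_coeffs_limit_le[OF u, of j] U(2) le_degree[of u j] by simp
  moreover have "a = (u * v, u * w)"
    using coeffs_tendsto_unique[OF coeffs_tendsto_mult[OF u v]] coeffs_tendsto_subseq[OF lim(1) s]
      coeffs_tendsto_unique[OF coeffs_tendsto_mult[OF u w]] coeffs_tendsto_subseq[OF lim(2) s]
    by (simp add: prod_eq_iff)
  ultimately show ?thesis
    using that[OF s u v w] by simp
qed

section \<open>Pairs and their greatest common divisors\<close>

abbreviation pair_gcd :: "complex poly \<times> complex poly \<Rightarrow> complex poly" where
  "pair_gcd x \<equiv> gcd (fst x) (snd x)"

lemma lead_coeff_pair_gcd:
  assumes "x \<in> deg_pairs m n"
  shows "lead_coeff (pair_gcd x) = 1"
proof -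
  have nz: "pair_gcd x \<noteq> 0"
    using assms by (auto simp: deg_pairs_def)
  then have "unit_factor (pair_gcd x) = 1"
    by (simp add: unit_factor_gcd)
  then show ?thesis
    using nz by (simp add: unit_factor_poly_def one_pCons unit_factor_field_def)
qed

lemma monic_common_divisor_eq_gcd:
  assumes x: "x \<in> deg_pairs m n" and u: "lead_coeff u = 1" "u dvd fst x" "u dvd snd x"
    and deg: "degree u = degree (pair_gcd x)"
  shows "u = pair_gcd x"
proof -
  have g: "lead_coeff (pair_gcd x) = 1"
    using x by (rule lead_coeff_pair_gcd)
  obtain q where q: "pair_gcd x = u * q"
    using u(2,3) by (meson dvdE gcd_greatest)
  with g u(1) have "u \<noteq> 0" "q \<noteq> 0"
    by auto
  then have "degree q = 0"
    using deg by (simp add: q degree_mult_eq)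
  moreover have "lead_coeff q = 1"
    using g u(1) lead_coeff_mult[of u q] by (simp add: q)
  ultimately have "q = 1"
    by (auto elim!: degree_eq_zeroE)
  with q show ?thesis by simp
qed

lemma degree_common_divisor_le:
  assumes "x \<in> deg_pairs m n" "u dvd fst x" "u dvd snd x"
  shows "degree u \<le> degree (pair_gcd x)"
  using assms by (intro dvd_imp_degree_le gcd_greatest) (auto simp: deg_pairs_def)

lemma exact_gcds_eq:
  assumes x: "x \<in> deg_pairs m n"
  shows "exact_gcds x = {smult \<alpha> (pair_gcd x) | \<alpha>. \<alpha> \<noteq> 0}"
proof (intro equalityI subsetI)
  have nz: "pair_gcd x \<noteq> 0"
    using x by (auto simp: deg_pairs_def)
  fix u assume u: "u \<in> exact_gcds x"
  have u0: "u \<noteq> 0"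
    using u x by (auto simp: exact_gcds_def deg_pairs_def)
  have "u dvd pair_gcd x"
    using u by (simp add: exact_gcds_def)
  then obtain q where q: "pair_gcd x = u * q"
    by (elim dvdE)
  have "degree (pair_gcd x) \<le> degree u"
    using u by (auto simp: exact_gcds_def)
  moreover have "q \<noteq> 0"
    using q nz by auto
  ultimately have "degree q = 0"
    using u0 by (simp add: q degree_mult_eq)
  then obtain c where "q = [:c:]" "c \<noteq> 0"
    using \<open>q \<noteq> 0\<close> by (auto elim!: degree_eq_zeroE)
  then have "u = smult (inverse c) (pair_gcd x)"
    by (simp add: q)
  then show "u \<in> {smult \<alpha> (pair_gcd x) | \<alpha>. \<alpha> \<noteq> 0}"
    using \<open>c \<noteq> 0\<close> by auto
next
  fix u assume "u \<in> {smult \<alpha> (pair_gcd x) | \<alpha>. \<alpha> \<noteq> 0}"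
  then obtain \<alpha> where \<alpha>: "u = smult \<alpha> (pair_gcd x)" "\<alpha> \<noteq> 0"
    by auto
  then show "u \<in> exact_gcds x"
    using degree_common_divisor_le[OF x] by (simp add: exact_gcds_def smult_dvd_iff)
qed

lemma gcd_deg_pairs_iff:
  "x \<in> gcd_deg_pairs m n k \<longleftrightarrow> x \<in> deg_pairs m n \<and> degree (pair_gcd x) = k"
proof -
  have "(\<exists>u\<in>exact_gcds x. degree u = k) \<longleftrightarrow> degree (pair_gcd x) = k" if "x \<in> deg_pairs m n"
    unfolding exact_gcds_eq[OF that] by (auto intro: exI[of _ "pair_gcd x"] exI[of _ "1::complex"])
  then show ?thesis
    by (auto simp: gcd_deg_pairs_def)
qed

lemma degree_pair_gcd_le:
  assumes "x \<in> deg_pairs m n"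
  shows "degree (pair_gcd x) \<le> min m n"
  using assms dvd_imp_degree_le[of "pair_gcd x" "fst x"] dvd_imp_degree_le[of "pair_gcd x" "snd x"]
  by (auto simp: deg_pairs_def)

lemma gcd_deg_pairs_nonempty:
  assumes "k \<le> min m n"
  shows "gcd_deg_pairs m n k \<noteq> {}"
proof -
  define X Y :: "complex poly" where "X = [:0, 1:]" and "Y = [:1, 1:]"
  define x where "x = (X ^ k * X ^ (m - k), X ^ k * Y ^ (n - k))"
  have "coprime X Y"
  proof (rule coprimeI)
    fix c assume "c dvd X" "c dvd Y"
    then have "c dvd Y - X" by (rule dvd_diff[rotated])
    then show "is_unit c" by (simp add: X_def Y_def one_pCons)
  qed
  then have "pair_gcd x = normalize (X ^ k)"
    by (simp add: x_def gcd_mult_left)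
  then have "degree (pair_gcd x) = degree (X ^ k)"
    by (metis X_def dvd_imp_degree_le dvd_normalize_iff dvd_refl normalize_dvd_iff normalize_eq_0_iff
        order_antisym pCons_eq_0_iff power_not_zero zero_neq_one)
  moreover have deg: "degree (X ^ j) = j" "degree (Y ^ j) = j" "X \<noteq> 0" "Y \<noteq> 0" for j
    by (simp_all add: X_def Y_def degree_linear_power)
  moreover have "x \<in> deg_pairs m n"
    using assms by (simp add: x_def deg_pairs_def degree_mult_eq deg)
  ultimately have "x \<in> gcd_deg_pairs m n k"
    by (simp add: gcd_deg_pairs_iff)
  then show ?thesis by blast
qed

text \<open>If \<open>Q\<close> failed arbitrarily close to \<open>a\<close>, it would fail along a whole sequence tending to \<open>a\<close>. In this
  form, extracting convergent subsequences yields statements that are uniform near \<open>a\<close>.\<close>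

lemma near_by_sequences:
  assumes "\<And>X. (\<And>i. X i \<in> A) \<Longrightarrow> (\<lambda>i::nat. pair_norm (X i - a)) \<longlonglongrightarrow> 0 \<Longrightarrow> \<exists>i. Q (X i)"
  shows "\<exists>\<delta>>0. \<forall>x\<in>A. pair_norm (x - a) < \<delta> \<longrightarrow> Q x"
proof (rule ccontr)
  assume *: "\<not> ?thesis"
  have "\<exists>x\<in>A. pair_norm (x - a) < inverse (real (Suc i)) \<and> \<not> Q x" for i
    using * by (metis inverse_positive_iff_positive of_nat_0_less_iff zero_less_Suc)
  then obtain X where X: "\<And>i. X i \<in> A" "\<And>i. pair_norm (X i - a) < inverse (real (Suc i))"
      "\<And>i. \<not> Q (X i)"
    by metis
  have "(\<lambda>i. pair_norm (X i - a)) \<longlonglongrightarrow> 0"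
    by (rule tendsto_sandwich[OF _ _ tendsto_const LIMSEQ_inverse_real_of_nat])
      (use X(2) in \<open>auto intro!: always_eventually less_imp_le\<close>)
  with assms X show False by blast
qed

lemma pair_gcds_subconverge:
  assumes X: "\<And>i. X i \<in> gcd_deg_pairs m n j" and a: "a \<in> deg_pairs m n"
    and lim: "coeffs_tendsto (\<lambda>i. fst (X i)) (fst a)" "coeffs_tendsto (\<lambda>i. snd (X i)) (snd a)"
  obtains s u v w where "strict_mono s" "coeffs_tendsto (\<lambda>i. pair_gcd (X (s i))) u"
    "coeffs_tendsto (\<lambda>i. fst (X (s i)) div pair_gcd (X (s i))) v"
    "coeffs_tendsto (\<lambda>i. snd (X (s i)) div pair_gcd (X (s i))) w"
    "lead_coeff u = 1" "degree u = j" "a = (u * v, u * w)"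
proof -
  have X': "X i \<in> deg_pairs m n" "degree (pair_gcd (X i)) = j" for i
    using X by (simp_all add: gcd_deg_pairs_iff)
  have eq: "pair_gcd (X i) * (fst (X i) div pair_gcd (X i)) = fst (X i)"
    "pair_gcd (X i) * (snd (X i) div pair_gcd (X i)) = snd (X i)" for i
    by simp_all
  have lc: "coeff (pair_gcd (X i)) j = 1" for i
    using lead_coeff_pair_gcd[OF X'(1)[of i]] X'(2)[of i] by simp
  show ?thesis
    by (rule common_divisor_limit[of "\<lambda>i. pair_gcd (X i)" "\<lambda>i. fst (X i) div pair_gcd (X i)"
          "\<lambda>i. snd (X i) div pair_gcd (X i)" m n a j])
      (use X' a lim lc that in \<open>simp_all add: eq\<close>)
qed

text \<open>The monic GCDs accumulate at a common divisor of the limit, so the GCD degree can only jump up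
  in a limit.\<close>

lemma gcd_degree_limit_ge:
  assumes "\<And>i. X i \<in> gcd_deg_pairs m n j" "a \<in> deg_pairs m n"
    and "coeffs_tendsto (\<lambda>i. fst (X i)) (fst a)" "coeffs_tendsto (\<lambda>i. snd (X i)) (snd a)"
  shows "j \<le> degree (pair_gcd a)"
proof -
  obtain u v w where "degree u = j" "a = (u * v, u * w)"
    using pair_gcds_subconverge[OF assms] .
  then show ?thesis
    using degree_common_divisor_le[OF assms(2), of u] by simp
qed

lemma gcd_degree_le_near:
  assumes a: "a \<in> gcd_deg_pairs m n k"
  shows "\<exists>\<delta>>0. \<forall>x\<in>deg_pairs m n. pair_norm (x - a) < \<delta> \<longrightarrow> degree (pair_gcd x) \<le> k"
proof -
  \<comment> \<open>One radius for each of the finitely many larger GCD degrees.\<close>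
  have "\<exists>\<delta>>0. \<forall>x\<in>gcd_deg_pairs m n j. pair_norm (x - a) < \<delta> \<longrightarrow> False" if "j > k" for j
  proof (rule near_by_sequences)
    fix X assume "\<And>i. X i \<in> gcd_deg_pairs m n j" "(\<lambda>i::nat. pair_norm (X i - a)) \<longlonglongrightarrow> 0"
    with a have "j \<le> degree (pair_gcd a)"
      by (intro gcd_degree_limit_ge coeffs_tendsto_of_pair_norm) (auto simp: gcd_deg_pairs_iff)
    with a that show "\<exists>i::nat. False"
      by (simp add: gcd_deg_pairs_iff)
  qed
  then obtain \<delta> where \<delta>: "\<And>j. j > k \<Longrightarrow> \<delta> j > 0"
    "\<And>j x. j > k \<Longrightarrow> x \<in> gcd_deg_pairs m n j \<Longrightarrow> \<not> pair_norm (x - a) < \<delta> j"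
    by metis
  define S where "S = insert 1 (\<delta> ` {k<..min m n})"
  have "finite S" "S \<noteq> {}" "\<And>s. s \<in> S \<Longrightarrow> s > 0"
    using \<delta>(1) by (auto simp: S_def)
  then have "Min S > 0"
    by simp
  moreover have "degree (pair_gcd x) \<le> k" if "x \<in> deg_pairs m n" "pair_norm (x - a) < Min S" for x
  proof (rule ccontr)
    assume "\<not> ?thesis"
    then have j: "degree (pair_gcd x) > k"
      by simp
    then have "\<delta> (degree (pair_gcd x)) \<in> S"
      using degree_pair_gcd_le[OF that(1)] by (auto simp: S_def)
    then have "pair_norm (x - a) < \<delta> (degree (pair_gcd x))"
      using that(2) \<open>finite S\<close> by (meson Min_le less_le_trans)
    then show False
      using \<delta>(2)[OF j, of x] that(1) by (simp add: gcd_deg_pairs_iff)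
  qed
  ultimately show ?thesis by blast
qed

text \<open>Any accumulation point of the monic GCDs is a monic common divisor of the limit, and it has full
  degree because the GCD degree is constant; so it is the monic GCD of the limit. This continuity
  fails where the GCD degree jumps.\<close>

lemma gcd_cofactors_tendsto:
  assumes a: "a \<in> gcd_deg_pairs m n k" and X: "\<And>i. X i \<in> gcd_deg_pairs m n k"
    and lim: "(\<lambda>i. pair_norm (X i - a)) \<longlonglongrightarrow> 0"
  shows "coeffs_tendsto (\<lambda>i. pair_gcd (X i)) (pair_gcd a)"
    and "coeffs_tendsto (\<lambda>i. fst (X i) div pair_gcd (X i)) (fst a div pair_gcd a)"
    and "coeffs_tendsto (\<lambda>i. snd (X i) div pair_gcd (X i)) (snd a div pair_gcd a)"
proof -
  have a': "a \<in> deg_pairs m n" "degree (pair_gcd a) = k"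
    using a by (simp_all add: gcd_deg_pairs_iff)
  have sub: "\<exists>s::nat \<Rightarrow> nat. strict_mono s \<and>
      coeffs_tendsto (\<lambda>i. pair_gcd (X (r (s i)))) (pair_gcd a) \<and>
      coeffs_tendsto (\<lambda>i. fst (X (r (s i))) div pair_gcd (X (r (s i)))) (fst a div pair_gcd a) \<and>
      coeffs_tendsto (\<lambda>i. snd (X (r (s i))) div pair_gcd (X (r (s i)))) (snd a div pair_gcd a)"
    if r: "strict_mono r" for r :: "nat \<Rightarrow> nat"
  proof -
    obtain s u v w where s: "strict_mono s" and
      lims: "coeffs_tendsto (\<lambda>i. pair_gcd (X (r (s i)))) u"
      "coeffs_tendsto (\<lambda>i. fst (X (r (s i))) div pair_gcd (X (r (s i)))) v"
      "coeffs_tendsto (\<lambda>i. snd (X (r (s i))) div pair_gcd (X (r (s i)))) w"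
      and u: "lead_coeff u = 1" "degree u = k" "a = (u * v, u * w)"
      using pair_gcds_subconverge[of "\<lambda>i. X (r i)", OF X a'(1)
        coeffs_tendsto_subseq[OF coeffs_tendsto_of_pair_norm(1)[OF lim] r]
        coeffs_tendsto_subseq[OF coeffs_tendsto_of_pair_norm(2)[OF lim] r]] .
    have u_eq: "u = pair_gcd a"
      using u a'(2) by (intro monic_common_divisor_eq_gcd[OF a'(1)]) auto
    have "u \<noteq> 0"
      using u(1) by auto
    then have "v = fst a div pair_gcd a" "w = snd a div pair_gcd a"
      unfolding u_eq[symmetric] by (simp_all add: u(3))
    with s lims u_eq show ?thesis by blast
  qed
  show "coeffs_tendsto (\<lambda>i. pair_gcd (X i)) (pair_gcd a)"
    and "coeffs_tendsto (\<lambda>i. fst (X i) div pair_gcd (X i)) (fst a div pair_gcd a)"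
    and "coeffs_tendsto (\<lambda>i. snd (X i) div pair_gcd (X i)) (snd a div pair_gcd a)"
    unfolding coeffs_tendsto_def
    by (intro allI LIMSEQ_if_subseqs_have_convergent_subseqs;
        use sub in \<open>unfold coeffs_tendsto_def, blast\<close>)+
qed

section \<open>Nearest pairs with prescribed GCD degree\<close>

definition nearest_pairs ::
  "nat \<Rightarrow> nat \<Rightarrow> nat \<Rightarrow> complex poly \<times> complex poly \<Rightarrow> (complex poly \<times> complex poly) set" where
  "nearest_pairs m n k x = {y \<in> gcd_deg_pairs m n k. pair_norm (y - x) = gcd_dist m n k x}"

lemma num_gcds_eq:
  "num_gcds m n \<epsilon> x =
    {smult \<alpha> (pair_gcd y) | \<alpha> y. \<alpha> \<noteq> 0 \<and> y \<in> nearest_pairs m n (num_gcd_degree m n \<epsilon> x) x}"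
proof -
  have "num_gcds m n \<epsilon> x = (\<Union>y\<in>nearest_pairs m n (num_gcd_degree m n \<epsilon> x) x. exact_gcds y)"
    by (auto simp: num_gcds_def nearest_pairs_def)
  also have "\<dots> = (\<Union>y\<in>nearest_pairs m n (num_gcd_degree m n \<epsilon> x) x. {smult \<alpha> (pair_gcd y) | \<alpha>. \<alpha> \<noteq> 0})"
    by (intro SUP_cong refl exact_gcds_eq[of _ m n]) (simp add: nearest_pairs_def gcd_deg_pairs_iff)
  finally show ?thesis
    by blast
qed

lemma gcd_dist_le: "y \<in> gcd_deg_pairs m n k \<Longrightarrow> gcd_dist m n k x \<le> pair_norm (x - y)"
  unfolding gcd_dist_def by (rule cInf_lower) (blast, auto intro!: bdd_belowI[of _ 0])

lemma gcd_dist_ge: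
  assumes "k \<le> min m n" "\<And>y. y \<in> gcd_deg_pairs m n k \<Longrightarrow> d \<le> pair_norm (x - y)"
  shows "d \<le> gcd_dist m n k x"
  unfolding gcd_dist_def
  by (rule cInf_greatest) (use assms gcd_deg_pairs_nonempty[OF assms(1)] in auto)

lemma gcd_dist_nonneg: "k \<le> min m n \<Longrightarrow> 0 \<le> gcd_dist m n k x"
  by (rule gcd_dist_ge) auto

lemma gcd_dist_self:
  assumes "a \<in> gcd_deg_pairs m n k"
  shows "gcd_dist m n k a = 0"
proof (rule antisym)
  show "gcd_dist m n k a \<le> 0"
    using gcd_dist_le[OF assms, of a] by simp
  show "0 \<le> gcd_dist m n k a"
    using assms degree_pair_gcd_le[of a m n] by (intro gcd_dist_nonneg) (auto simp: gcd_deg_pairs_iff)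
qed

lemma nearest_pairs_close:
  assumes "a \<in> gcd_deg_pairs m n k" "y \<in> nearest_pairs m n k x"
  shows "pair_norm (y - a) \<le> 2 * pair_norm (x - a)"
proof -
  have "pair_norm (y - x) \<le> pair_norm (x - a)"
    using assms gcd_dist_le[of a m n k x] by (simp add: nearest_pairs_def)
  then show ?thesis
    using pair_norm_diff_triangle[of y a x] by simp
qed

lemma nearest_pairs_tendsto:
  assumes "a \<in> gcd_deg_pairs m n k" "\<And>i. Y i \<in> nearest_pairs m n k (X i)"
    and "(\<lambda>i. pair_norm (X i - a)) \<longlonglongrightarrow> 0"
  shows "(\<lambda>i. pair_norm (Y i - a)) \<longlonglongrightarrow> 0"
  by (rule tendsto_0_le[OF assms(3), of _ 2])
    (use nearest_pairs_close[OF assms(1,2)] in \<open>auto simp: mult.commute\<close>)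


section \<open>Uniqueness of the nearest pair\<close>

text \<open>Both equations say that \<open>u\<close> divides a product with the factor \<open>hu\<close>, so by coprimality of the
  cofactors \<open>u\<close> divides \<open>hu\<close>, which has smaller degree. The pair of left hand sides is
  the differential of \<open>(u, v, w) \<mapsto> (u v, u w)\<close>, and the degree condition describes the
  directions that keep \<open>u\<close> monic.\<close>

lemma product_differential_injective:
  fixes u v w hu hv hw :: "complex poly"
  assumes "coprime v w" "u \<noteq> 0" "\<And>j. degree u \<le> j \<Longrightarrow> coeff hu j = 0"
    and eq: "u * hv + hu * v = 0" "u * hw + hu * w = 0"
  shows "hu = 0" "hv = 0" "hw = 0"
proof -
  have "hu * v = u * (- hv)" "hu * w = u * (- hw)"
    using eq by (simp_all add: eq_neg_iff_add_eq_0 add.commute)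
  then have "u dvd gcd (hu * v) (hu * w)"
    by (metis dvd_triv_left gcd_greatest)
  then have "u dvd hu"
    using assms(1) by (simp add: gcd_mult_left)
  show "hu = 0"
  proof (rule ccontr)
    assume "hu \<noteq> 0"
    then have "degree u \<le> degree hu" "lead_coeff hu \<noteq> 0"
      using \<open>u dvd hu\<close> by (auto intro: dvd_imp_degree_le)
    then show False
      using assms(3) by blast
  qed
  then show "hv = 0" "hw = 0"
    using eq assms(2) by simp_all
qed

text \<open>For \<open>B = 0\<close> this says that the midpoint of two different points of a sphere is strictly closer
  to the centre. In general \<open>A + B\<close> is the midpoint, and the parallelogram identity bounds \<open>J\<close> by the
  amount by which \<open>A + B\<close> can be closer to the origin than \<open>A\<close>.\<close>

lemma midpoint_estimate:
  assumes "pair_norm (A + J + B) = d" "pair_norm (A - J + B) = d" "d \<le> pair_norm A"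
  shows "(pair_norm J)\<^sup>2 \<le> 2 * pair_norm A * pair_norm B"
proof -
  have "d \<ge> 0"
    using assms(1) pair_norm_nonneg by metis
  have "pair_norm A \<le> pair_norm (A + B) + pair_norm B"
    using pair_norm_diff_triangle[of A 0 "A + B"] pair_norm_minus_commute[of A "A + B"] by simp
  have "(pair_norm A)\<^sup>2 - 2 * pair_norm A * pair_norm B \<le> (pair_norm (A + B))\<^sup>2"
  proof (cases "pair_norm B \<le> pair_norm A")
    case True
    then have "(pair_norm A - pair_norm B)\<^sup>2 \<le> (pair_norm (A + B))\<^sup>2"
      using \<open>pair_norm A \<le> pair_norm (A + B) + pair_norm B\<close> by (intro power_mono) auto
    moreover have "0 \<le> (pair_norm B)\<^sup>2"
      by simp
    ultimately show ?thesis
      unfolding power2_diff by linarith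
  next
    case False
    then have "pair_norm A * pair_norm A \<le> pair_norm A * pair_norm B"
      by (intro mult_left_mono) auto
    moreover have "0 \<le> pair_norm A * pair_norm B" "0 \<le> (pair_norm (A + B))\<^sup>2"
      by simp_all
    ultimately show ?thesis
      unfolding power2_eq_square by linarith
  qed
  moreover have "2 * d\<^sup>2 = 2 * (pair_norm (A + B))\<^sup>2 + 2 * (pair_norm J)\<^sup>2"
    using pair_norm_parallelogram[of "A + B" J] assms(1,2) by (simp add: algebra_simps)
  moreover have "d\<^sup>2 \<le> (pair_norm A)\<^sup>2"
    using assms(3) \<open>d \<ge> 0\<close> by (rule power_mono)
  ultimately show ?thesis by linarith
qed

text \<open>The degrees cannot drop because the leading coefficients converge to those of \<open>a\<close>; the GCD
  degree is at least \<open>k\<close> because of the factor \<open>U i\<close>, and at most \<open>k\<close> close to \<open>a\<close>. This makes pairs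
  with averaged factors admissible competitors.\<close>

lemma factored_pairs_near:
  assumes a: "a \<in> gcd_deg_pairs m n k"
    and M: "\<And>i. lead_coeff (U i) = 1" "\<And>i. degree (U i) = k"
    and degs: "\<And>i. degree (U i * V i) \<le> m" "\<And>i. degree (U i * W i) \<le> n"
    and lim: "coeffs_tendsto (\<lambda>i. U i * V i) (fst a)" "coeffs_tendsto (\<lambda>i. U i * W i) (snd a)"
  shows "\<forall>\<^sub>F i in sequentially. (U i * V i, U i * W i) \<in> gcd_deg_pairs m n k"
proof -
  have a': "fst a \<noteq> 0" "snd a \<noteq> 0" "degree (fst a) = m" "degree (snd a) = n"
    using a by (auto simp: gcd_deg_pairs_iff deg_pairs_def)
  obtain \<delta> where \<delta>: "\<delta> > 0"
    "\<And>x. x \<in> deg_pairs m n \<Longrightarrow> pair_norm (x - a) < \<delta> \<Longrightarrow> degree (pair_gcd x) \<le> k"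
    using gcd_degree_le_near[OF a] by blast
  have "(\<lambda>i. pair_norm ((U i * V i, U i * W i) - a)) \<longlonglongrightarrow> pair_norm (a - a)"
  proof (rule tendsto_pair_norm)
    show "coeffs_tendsto (\<lambda>i. fst ((U i * V i, U i * W i) - a)) (fst (a - a))"
      "coeffs_tendsto (\<lambda>i. snd ((U i * V i, U i * W i) - a)) (snd (a - a))"
      using lim(1)[THEN coeffs_tendsto_diff, OF coeffs_tendsto_const, of "fst a"]
        lim(2)[THEN coeffs_tendsto_diff, OF coeffs_tendsto_const, of "snd a"] by simp_all
    show "degree (fst ((U i * V i, U i * W i) - a)) \<le> max m n" 
      "degree (snd ((U i * V i, U i * W i) - a)) \<le> max m n" for i
      using degs[of i] a' by (auto intro!: degree_diff_le simp: le_max_iff_disj)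
  qed
  then have near: "\<forall>\<^sub>F i in sequentially. pair_norm ((U i * V i, U i * W i) - a) < \<delta>"
    using \<delta>(1) by (intro order_tendstoD) auto
  have "\<forall>\<^sub>F i in sequentially. coeff (U i * V i) m \<noteq> 0" "\<forall>\<^sub>F i in sequentially. coeff (U i * W i) n \<noteq> 0"
    using lim a' by (auto simp: coeffs_tendsto_def intro!: tendsto_imp_eventually_ne)
  with near show ?thesis
  proof eventually_elim
    case (elim i)
    have "degree (U i * V i) = m" "degree (U i * W i) = n"
      using elim(2,3) degs[of i] le_degree by (auto intro: antisym)
    with elim(2,3) have x: "(U i * V i, U i * W i) \<in> deg_pairs m n"
      by (auto simp: deg_pairs_def)
    moreover have "degree (pair_gcd (U i * V i, U i * W i)) = k"
      using \<delta>(2)[OF x elim(1)] degree_common_divisor_le[OF x, of "U i"] M(2)[of i] by auto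
    ultimately show ?case
      by (simp add: gcd_deg_pairs_iff)
  qed
qed

text \<open>Two sequences \<open>Y\<close> and \<open>Z\<close> of different nearest pairs are written through midpoints and half
  differences of their monic GCDs and cofactors. The midpoints converge to the factors of \<open>a\<close>, the
  normalised half differences accumulate at a nonzero direction, and \<open>midpoint_estimate\<close> puts that
  direction into the kernel of the differential at the factors of \<open>a\<close>.\<close>

lemma nearest_pair_unique_near:
  assumes a: "a \<in> gcd_deg_pairs m n k"
  shows "\<exists>\<delta>>0. \<forall>x\<in>deg_pairs m n. pair_norm (x - a) < \<delta> \<longrightarrow>
    (\<forall>y\<in>nearest_pairs m n k x. \<forall>z\<in>nearest_pairs m n k x. y = z)"
proof (rule near_by_sequences, rule ccontr)
  fix X :: "nat \<Rightarrow> complex poly \<times> complex poly"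
  assume X: "\<And>i. X i \<in> deg_pairs m n" and X_lim: "(\<lambda>i. pair_norm (X i - a)) \<longlonglongrightarrow> 0"
    and "\<not> (\<exists>i. \<forall>y\<in>nearest_pairs m n k (X i). \<forall>z\<in>nearest_pairs m n k (X i). y = z)"
  then obtain Y Z where Y: "\<And>i. Y i \<in> nearest_pairs m n k (X i)"
    and Z: "\<And>i. Z i \<in> nearest_pairs m n k (X i)" and YZ: "\<And>i. Y i \<noteq> Z i"
    by metis
  have Y': "Y i \<in> gcd_deg_pairs m n k" and Z': "Z i \<in> gcd_deg_pairs m n k" for i
    using Y[of i] Z[of i] by (simp_all add: nearest_pairs_def)
  define u v w where "u = pair_gcd a" and "v = fst a div u" and "w = snd a div u"
  define uy vy wy where "uy i = pair_gcd (Y i)" and "vy i = fst (Y i) div uy i"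
    and "wy i = snd (Y i) div uy i" for i
  define uz vz wz where "uz i = pair_gcd (Z i)" and "vz i = fst (Z i) div uz i"
    and "wz i = snd (Z i) div uz i" for i
  have lim_y: "coeffs_tendsto uy u" "coeffs_tendsto vy v" "coeffs_tendsto wy w"
    using gcd_cofactors_tendsto[OF a Y' nearest_pairs_tendsto[OF a Y X_lim]]
    by (simp_all add: u_def v_def w_def uy_def[abs_def] vy_def[abs_def] wy_def[abs_def])
  have lim_z: "coeffs_tendsto uz u" "coeffs_tendsto vz v" "coeffs_tendsto wz w"
    using gcd_cofactors_tendsto[OF a Z' nearest_pairs_tendsto[OF a Z X_lim]]
    by (simp_all add: u_def v_def w_def uz_def[abs_def] vz_def[abs_def] wz_def[abs_def])

  have a': "a \<in> deg_pairs m n" and km: "k \<le> m" "k \<le> n"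
    using a degree_pair_gcd_le[of a m n] by (auto simp: gcd_deg_pairs_iff)
  have a_eq: "a = (u * v, u * w)"
    by (simp add: u_def v_def w_def prod_eq_iff)
  have u: "u \<noteq> 0" "degree u = k" and "coprime v w"
    using a a' by (auto simp: u_def v_def w_def gcd_deg_pairs_iff deg_pairs_def intro!: div_gcd_coprime)
  have monic: "coeff (uy i) k = 1" "coeff (uz i) k = 1" "degree (uy i) = k" "degree (uz i) = k" for i
    using Y'[of i] Z'[of i] lead_coeff_pair_gcd[of "Y i" m n] lead_coeff_pair_gcd[of "Z i" m n]
    by (auto simp: uy_def uz_def gcd_deg_pairs_iff)
  have Y_eq: "Y i = (uy i * vy i, uy i * wy i)" and Z_eq: "Z i = (uz i * vz i, uz i * wz i)" for i
    by (simp_all add: uy_def vy_def wy_def uz_def vz_def wz_def prod_eq_iff)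
  have degs: "degree (vy i) = m - k" "degree (vz i) = m - k" "degree (wy i) = n - k" "degree (wz i) = n - k" for i
    using Y'[of i] Z'[of i] monic[of i] unfolding Y_eq Z_eq
    by (auto simp: gcd_deg_pairs_iff deg_pairs_def degree_mult_eq)

  \<comment> \<open>The pairs \<open>Y i\<close> and \<open>Z i\<close> have the factors \<open>mu i - hu i, \<dots>\<close> and \<open>mu i + hu i, \<dots>\<close>.\<close>
  define mu mv mw where "mu i = smult (1/2) (uy i + uz i)" and "mv i = smult (1/2) (vy i + vz i)"
    and "mw i = smult (1/2) (wy i + wz i)" for i
  define hu hv hw where "hu i = smult (1/2) (uz i - uy i)" and "hv i = smult (1/2) (vz i - vy i)"
    and "hw i = smult (1/2) (wz i - wy i)" for i
  have halves: "smult (1/2) (p + q) - smult (1/2) (q - p) = p"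
    "smult (1/2) (p + q) + smult (1/2) (q - p) = q" for p q :: "complex poly"
    by (auto simp: poly_eq_iff field_simps)
  have y_eq: "uy i = mu i - hu i" "vy i = mv i - hv i" "wy i = mw i - hw i"
    and z_eq: "uz i = mu i + hu i" "vz i = mv i + hv i" "wz i = mw i + hw i" for i
    unfolding mu_def mv_def mw_def hu_def hv_def hw_def halves by simp_all
  have lim_m: "coeffs_tendsto mu u" "coeffs_tendsto mv v" "coeffs_tendsto mw w"
  proof -
    have "coeffs_tendsto (\<lambda>i. smult (1/2) (P i + Q i)) p"
      if "coeffs_tendsto P p" "coeffs_tendsto Q p" for P Q p
      using coeffs_tendsto_add[OF that[THEN coeffs_tendsto_smult, of "1/2"]] by (simp add: smult_add_right flip: smult_add_left)
    then show "coeffs_tendsto mu u" "coeffs_tendsto mv v" "coeffs_tendsto mw w"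
      using lim_y lim_z by (simp_all add: mu_def[abs_def] mv_def[abs_def] mw_def[abs_def])
  qed
  have deg_m: "degree (mv i) \<le> m - k" "degree (mw i) \<le> n - k" "degree (mu i) \<le> k" for i
    using degs[of i] monic[of i] by (auto simp: mu_def mv_def mw_def intro!: degree_add_le)
  have deg_h: "degree (hv i) \<le> m + n" "degree (hw i) \<le> m + n" "degree (hu i) \<le> m + n" for i
    using degs[of i] monic[of i] km by (auto simp: hu_def hv_def hw_def intro!: degree_diff_le)
  have "coeff (mu i) k = 1" for i
    using monic[of i] by (simp add: mu_def)
  then have monic_m: "lead_coeff (mu i) = 1" "degree (mu i) = k" for i
    using deg_m(3)[of i] le_degree[of "mu i" k] by (metis antisym zero_neq_one)+
  have deg_M: "degree (mu i * mv i) \<le> m" "degree (mu i * mw i) \<le> n" for i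
    using degree_mult_le[of "mu i" "mv i"] degree_mult_le[of "mu i" "mw i"] deg_m[of i] km by linarith+

  \<comment> \<open>\<open>D\<close> is the differential of the product map at the midpoint, \<open>B\<close> its quadratic part.\<close>
  define A where "A i = (mu i * mv i, mu i * mw i) - X i" for i
  define D where "D i hu hv hw = (mu i * hv + hu * mv i, mu i * hw + hu * mw i)" for i hu hv hw
  define B :: "complex poly \<Rightarrow> complex poly \<Rightarrow> complex poly \<Rightarrow> complex poly \<times> complex poly"
    where "B hu hv hw = (hu * hv, hu * hw)" for hu hv hw
  have ZX: "Z i - X i = A i + D i (hu i) (hv i) (hw i) + B (hu i) (hv i) (hw i)"
    and YX: "Y i - X i = A i - D i (hu i) (hv i) (hw i) + B (hu i) (hv i) (hw i)" for i
    unfolding Y_eq Z_eq y_eq z_eq A_def D_def B_def by (auto simp: prod_eq_iff algebra_simps)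
  have lim_M: "coeffs_tendsto (\<lambda>i. mu i * mv i) (fst a)" "coeffs_tendsto (\<lambda>i. mu i * mw i) (snd a)"
    using coeffs_tendsto_mult lim_m by (simp_all add: a_eq)
  have ev: "\<forall>\<^sub>F i in sequentially. (mu i * mv i, mu i * mw i) \<in> gcd_deg_pairs m n k"
    using factored_pairs_near[OF a monic_m deg_M lim_M] .

  define t where "t i = poly_norm (hu i) + poly_norm (hv i) + poly_norm (hw i)" for i
  have t: "t i > 0" for i
  proof (rule ccontr)
    assume "\<not> t i > 0"
    then have "poly_norm (hu i) = 0" "poly_norm (hv i) = 0" "poly_norm (hw i) = 0"
      using poly_norm_nonneg[of "hu i"] poly_norm_nonneg[of "hv i"] poly_norm_nonneg[of "hw i"]
      unfolding t_def by linarith+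
    then have "Y i = Z i"
      by (simp add: Y_eq Z_eq y_eq z_eq)
    with YZ show False by blast
  qed
  define nm where "nm i p = smult (of_real (inverse (t i))) p" for i and p :: "complex poly"
  define gu gv gw where "gu i = nm i (hu i)" and "gv i = nm i (hv i)" and "gw i = nm i (hw i)" for i
  have h_eq: "hu i = smult (of_real (t i)) (gu i)" "hv i = smult (of_real (t i)) (gv i)"
    "hw i = smult (of_real (t i)) (gw i)" for i
    using t[of i] by (simp_all add: gu_def gv_def gw_def nm_def flip: of_real_mult)
  have norm_g: "poly_norm (gu i) + poly_norm (gv i) + poly_norm (gw i) = 1" for i
  proof -
    have "poly_norm (nm i p) = poly_norm p / t i" for p
      using t[of i] by (simp add: nm_def poly_norm_smult norm_inverse norm_divide field_simps)
    then show ?thesis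
      using t[of i] by (simp add: gu_def gv_def gw_def add_divide_distrib[symmetric] flip: t_def)
  qed
  have g_le: "poly_norm (gu i) \<le> 1" "poly_norm (gv i) \<le> 1" "poly_norm (gw i) \<le> 1" for i
    using norm_g[of i] poly_norm_nonneg[of "gu i"] poly_norm_nonneg[of "gv i"]
      poly_norm_nonneg[of "gw i"] by linarith+
  have deg_g: "degree (gu i) \<le> m + n" "degree (gv i) \<le> m + n" "degree (gw i) \<le> m + n" for i
    using deg_h[of i] by (simp_all add: gu_def gv_def gw_def nm_def)
  obtain s gu' gv' gw' where s: "strict_mono s" and lim_g: "coeffs_tendsto (\<lambda>i. gu (s i)) gu'"
    "coeffs_tendsto (\<lambda>i. gv (s i)) gv'" "coeffs_tendsto (\<lambda>i. gw (s i)) gw'"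
    using bounded_poly_triples_subseq[OF deg_g g_le] .

  \<comment> \<open>The estimate is homogeneous of degree 2 in the half difference, so it holds for
    the normalised half difference, whose limit is not zero.\<close>
  have "\<forall>\<^sub>F i in sequentially.
    (pair_norm (D i (gu i) (gv i) (gw i)))\<^sup>2 \<le> 2 * pair_norm (A i) * pair_norm (B (gu i) (gv i) (gw i))"
    using ev
  proof eventually_elim
    case (elim i)
    have "(pair_norm (D i (hu i) (hv i) (hw i)))\<^sup>2
        \<le> 2 * pair_norm (A i) * pair_norm (B (hu i) (hv i) (hw i))"
    proof (rule midpoint_estimate)
      show "pair_norm (A i + D i (hu i) (hv i) (hw i) + B (hu i) (hv i) (hw i)) = gcd_dist m n k (X i)"
        using Z[of i] by (simp add: nearest_pairs_def flip: ZX)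
      show "pair_norm (A i - D i (hu i) (hv i) (hw i) + B (hu i) (hv i) (hw i)) = gcd_dist m n k (X i)"
        using Y[of i] by (simp add: nearest_pairs_def flip: YX)
      show "gcd_dist m n k (X i) \<le> pair_norm (A i)"
        using gcd_dist_le[OF elim, of "X i"] unfolding A_def by (subst pair_norm_minus_commute)
    qed
    moreover have "D i (hu i) (hv i) (hw i) =
        (smult (of_real (t i)) (fst (D i (gu i) (gv i) (gw i))),
         smult (of_real (t i)) (snd (D i (gu i) (gv i) (gw i))))"
      by (simp add: D_def h_eq smult_add_right)
    then have "pair_norm (D i (hu i) (hv i) (hw i)) = t i * pair_norm (D i (gu i) (gv i) (gw i))"
      using t[of i] by (simp add: pair_norm_smult)
    moreover have "B (hu i) (hv i) (hw i) =
        (smult (of_real ((t i)\<^sup>2)) (fst (B (gu i) (gv i) (gw i))),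
         smult (of_real ((t i)\<^sup>2)) (snd (B (gu i) (gv i) (gw i))))"
      by (simp add: B_def h_eq power2_eq_square)
    then have "pair_norm (B (hu i) (hv i) (hw i)) = (t i)\<^sup>2 * pair_norm (B (gu i) (gv i) (gw i))"
      using t[of i] by (simp add: pair_norm_smult norm_power)
    ultimately have "(t i)\<^sup>2 * (pair_norm (D i (gu i) (gv i) (gw i)))\<^sup>2
        \<le> (t i)\<^sup>2 * (2 * pair_norm (A i) * pair_norm (B (gu i) (gv i) (gw i)))"
      by (simp add: power_mult_distrib algebra_simps)
    then show ?case
      using t[of i] by simp
  qed
  then have ev_s: "\<forall>\<^sub>F i in sequentially. (pair_norm (D (s i) (gu (s i)) (gv (s i)) (gw (s i))))\<^sup>2
      \<le> 2 * pair_norm (A (s i)) * pair_norm (B (gu (s i)) (gv (s i)) (gw (s i)))"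
    by (rule eventually_subseq[OF s])
  have deg_mult: "degree (p * q) \<le> (m + n) + (m + n)"
    if "degree p \<le> m + n" "degree q \<le> m + n" for p q :: "complex poly"
    using degree_mult_le[of p q] that by linarith
  have deg_m': "degree (mu i) \<le> m + n" "degree (mv i) \<le> m + n" "degree (mw i) \<le> m + n" for i
    using deg_m[of i] km by linarith+
  have lim_ms: "coeffs_tendsto (\<lambda>i. mu (s i)) u" "coeffs_tendsto (\<lambda>i. mv (s i)) v"
    "coeffs_tendsto (\<lambda>i. mw (s i)) w"
    using lim_m s by (simp_all add: coeffs_tendsto_subseq)
  have "(\<lambda>i. pair_norm (D (s i) (gu (s i)) (gv (s i)) (gw (s i))))
      \<longlonglongrightarrow> pair_norm (u * gv' + gu' * v, u * gw' + gu' * w)"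
    unfolding D_def by (rule tendsto_pair_norm)
      (use lim_ms lim_g in \<open>auto intro!: coeffs_tendsto_add coeffs_tendsto_mult degree_add_le
        deg_mult deg_g deg_m'\<close>)
  moreover have "(\<lambda>i. pair_norm (B (gu (s i)) (gv (s i)) (gw (s i)))) \<longlonglongrightarrow> pair_norm (gu' * gv', gu' * gw')"
    unfolding B_def by (rule tendsto_pair_norm)
      (use lim_g in \<open>auto intro!: coeffs_tendsto_mult deg_mult deg_g\<close>)
  moreover have "(\<lambda>i. pair_norm (A (s i))) \<longlonglongrightarrow> pair_norm (a - a)"
  proof -
    have "(\<lambda>i. pair_norm (A i)) \<longlonglongrightarrow> pair_norm (a - a)"
    proof (rule tendsto_pair_norm)
      show "coeffs_tendsto (\<lambda>i. fst (A i)) (fst (a - a))" "coeffs_tendsto (\<lambda>i. snd (A i)) (snd (a - a))"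
        using coeffs_tendsto_diff[OF lim_M(1) coeffs_tendsto_of_pair_norm(1)[OF X_lim]]
          coeffs_tendsto_diff[OF lim_M(2) coeffs_tendsto_of_pair_norm(2)[OF X_lim]]
        by (simp_all add: A_def[abs_def])
      show "degree (fst (A i)) \<le> m + n" "degree (snd (A i)) \<le> m + n" for i
        using deg_M[of i] X[of i] by (auto simp: A_def deg_pairs_def intro!: degree_diff_le)
    qed
    then show ?thesis
      using LIMSEQ_subseq_LIMSEQ[OF _ s] by (simp add: o_def)
  qed
  ultimately have "(pair_norm (u * gv' + gu' * v, u * gw' + gu' * w))\<^sup>2
      \<le> 2 * pair_norm (a - a) * pair_norm (gu' * gv', gu' * gw')"
    by (intro tendsto_le[OF sequentially_bot _ _ ev_s] tendsto_intros)
  then have "(u * gv' + gu' * v, u * gw' + gu' * w) = 0"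
    by simp
  then have kernel: "u * gv' + gu' * v = 0" "u * gw' + gu' * w = 0"
    by (simp_all add: zero_prod_def)
  have "coeff gu' j = 0" if "degree u \<le> j" for j
  proof -
    have "coeff (gu i) j = 0" for i
      using that u(2) monic[of i] by (cases "j = k") (auto simp: gu_def nm_def hu_def coeff_eq_0)
    then show ?thesis
      using lim_g(1) by (auto simp: coeffs_tendsto_def LIMSEQ_const_iff dest!: spec[of _ j])
  qed
  note zero = product_differential_injective[OF \<open>coprime v w\<close> u(1) this kernel]
  have "(\<lambda>i. poly_norm (gu (s i)) + poly_norm (gv (s i)) + poly_norm (gw (s i)))
      \<longlonglongrightarrow> poly_norm gu' + poly_norm gv' + poly_norm gw'"
    by (intro tendsto_add tendsto_poly_norm[OF lim_g(1) deg_g(1)] tendsto_poly_norm[OF lim_g(2) deg_g(2)]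
        tendsto_poly_norm[OF lim_g(3) deg_g(3)])
  then show False
    by (simp add: norm_g zero LIMSEQ_const_iff)
qed

section \<open>Existence of nearest pairs\<close>

lemma num_gcd_degree_properties:
  assumes "x \<in> deg_pairs m n" "\<epsilon> > 0"
  shows "num_gcd_degree m n \<epsilon> x \<le> min m n"
    and "gcd_dist m n (num_gcd_degree m n \<epsilon> x) x < \<epsilon>"
    and "\<And>j. j \<le> min m n \<Longrightarrow> gcd_dist m n j x < \<epsilon> \<Longrightarrow> j \<le> num_gcd_degree m n \<epsilon> x"
proof -
  let ?S = "{j. j \<le> min m n \<and> gcd_dist m n j x < \<epsilon>}"
  have "finite ?S"
    by (rule finite_subset[of _ "{..min m n}"]) auto
  moreover have "degree (pair_gcd x) \<in> ?S"
    using assms degree_pair_gcd_le[OF assms(1)] gcd_dist_self[of x m n "degree (pair_gcd x)"]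
    by (simp add: gcd_deg_pairs_iff)
  ultimately have "num_gcd_degree m n \<epsilon> x \<in> ?S" "\<And>j. j \<in> ?S \<Longrightarrow> j \<le> num_gcd_degree m n \<epsilon> x"
    using Max_in[of ?S] Max_ge[of ?S] unfolding num_gcd_degree_def by blast+
  then show "num_gcd_degree m n \<epsilon> x \<le> min m n" "gcd_dist m n (num_gcd_degree m n \<epsilon> x) x < \<epsilon>"
    and "\<And>j. j \<le> min m n \<Longrightarrow> gcd_dist m n j x < \<epsilon> \<Longrightarrow> j \<le> num_gcd_degree m n \<epsilon> x"
    by simp_all
qed

text \<open>A minimising sequence accumulates at some pair, whose degrees are still \<open>m\<close> and \<open>n\<close> because
  it is closer to \<open>x\<close> than the leading coefficients of \<open>x\<close> are large. Its GCD degree could only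
  be larger than prescribed, and the maximality in the choice of the numerical GCD degree
  rules this out. So the infimum is attained for every small \<open>\<epsilon>\<close>, whatever that degree is.\<close>

lemma nearest_pairs_nonempty:
  assumes x: "x \<in> deg_pairs m n" and "\<epsilon> > 0"
    and \<epsilon>: "\<epsilon> \<le> cmod (lead_coeff (fst x))" "\<epsilon> \<le> cmod (lead_coeff (snd x))"
  shows "nearest_pairs m n (num_gcd_degree m n \<epsilon> x) x \<noteq> {}"
proof -
  define k where "k = num_gcd_degree m n \<epsilon> x"
  define d where "d = gcd_dist m n k x"
  have k: "k \<le> min m n" and d: "d < \<epsilon>"
    and max: "\<And>j. j \<le> min m n \<Longrightarrow> gcd_dist m n j x < \<epsilon> \<Longrightarrow> j \<le> k"
    unfolding d_def k_def using num_gcd_degree_properties[OF x \<open>\<epsilon> > 0\<close>] by auto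
  have "\<exists>y\<in>gcd_deg_pairs m n k. pair_norm (x - y) < d + inverse (real (Suc i))" for i
  proof (rule ccontr)
    assume "\<not> ?thesis"
    then have "d + inverse (real (Suc i)) \<le> d"
      unfolding d_def using k by (intro gcd_dist_ge) (auto simp: not_less)
    then show False
      using inverse_positive_iff_positive[of "real (Suc i)"] by linarith
  qed
  then obtain Y where Y: "\<And>i. Y i \<in> gcd_deg_pairs m n k"
    and Y_less: "\<And>i. pair_norm (x - Y i) < d + inverse (real (Suc i))"
    by metis
  have deg: "degree (fst (Y i)) = m" "degree (snd (Y i)) = n" for i
    using Y[of i] by (auto simp: gcd_deg_pairs_iff deg_pairs_def)
  then have degs: "degree (fst (Y i)) \<le> m + n" "degree (snd (Y i)) \<le> m + n" for i
    by simp_all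
  have bound: "poly_norm (fst (Y i)) \<le> d + 1 + pair_norm x" "poly_norm (snd (Y i)) \<le> d + 1 + pair_norm x" for i
  proof -
    have "inverse (real (Suc i)) \<le> 1"
      by (simp add: field_simps)
    then have "pair_norm (Y i) \<le> d + 1 + pair_norm x"
      using pair_norm_triangle[of "Y i - x" x] Y_less[of i] pair_norm_minus_commute[of x "Y i"] by simp
    then show "poly_norm (fst (Y i)) \<le> d + 1 + pair_norm x" "poly_norm (snd (Y i)) \<le> d + 1 + pair_norm x"
      using poly_norm_le_pair_norm[of "Y i"] by linarith+
  qed
  obtain s p q q' where s: "strict_mono s" and lim: "coeffs_tendsto (\<lambda>i. fst (Y (s i))) p"
      "coeffs_tendsto (\<lambda>i. snd (Y (s i))) q" and "coeffs_tendsto (\<lambda>i. snd (Y (s i))) q'"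
    using bounded_poly_triples_subseq[OF degs(1,2,2) bound(1,2,2)] .
  define y where "y = (p, q)"
  have xm: "fst x \<noteq> 0" "snd x \<noteq> 0" "degree (fst x) = m" "degree (snd x) = n"
    using x by (auto simp: deg_pairs_def)

  have "(\<lambda>i. pair_norm (x - Y (s i))) \<longlonglongrightarrow> pair_norm (x - y)"
    by (rule tendsto_pair_norm[where N = "m + n"])
      (use lim deg xm in \<open>auto simp: y_def intro!: coeffs_tendsto_diff coeffs_tendsto_const degree_diff_le\<close>)
  moreover have "(\<lambda>i. d + inverse (real (Suc (s i)))) \<longlonglongrightarrow> d + 0"
    using LIMSEQ_subseq_LIMSEQ[OF LIMSEQ_inverse_real_of_nat s]
    by (intro tendsto_add tendsto_const) (simp add: o_def)
  ultimately have "pair_norm (x - y) \<le> d + 0"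
    by (rule LIMSEQ_le) (use Y_less in \<open>blast intro: less_imp_le\<close>)
  then have xy: "pair_norm (x - y) \<le> d"
    by simp

  have "cmod (coeff (fst x) m - coeff p m) < cmod (coeff (fst x) m)"
    "cmod (coeff (snd x) n - coeff q n) < cmod (coeff (snd x) n)"
    using cmod_coeff_le_poly_norm[of "fst x - p" m] cmod_coeff_le_poly_norm[of "snd x - q" n]
      poly_norm_le_pair_norm[of "x - y"] xy d \<epsilon> xm by (simp_all add: y_def)
  then have "coeff p m \<noteq> 0" "coeff q n \<noteq> 0"
    by auto
  moreover have "degree p \<le> m" "degree q \<le> n"
    using degree_coeffs_limit_le[OF lim(1)] degree_coeffs_limit_le[OF lim(2)] deg by auto
  ultimately have y: "y \<in> deg_pairs m n"
    using le_degree[of p m] le_degree[of q n] by (auto simp: y_def deg_pairs_def)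
  have "k \<le> degree (pair_gcd y)"
    using gcd_degree_limit_ge[of "\<lambda>i. Y (s i)", OF Y y] lim by (simp add: y_def)
  moreover have "degree (pair_gcd y) \<le> k"
  proof (rule max)
    show "degree (pair_gcd y) \<le> min m n"
      by (rule degree_pair_gcd_le[OF y])
    show "gcd_dist m n (degree (pair_gcd y)) x < \<epsilon>"
      using gcd_dist_le[of y m n "degree (pair_gcd y)" x] y xy d by (simp add: gcd_deg_pairs_iff)
  qed
  ultimately have yk: "y \<in> gcd_deg_pairs m n k"
    using y by (simp add: gcd_deg_pairs_iff)
  then have "pair_norm (y - x) = d"
    using gcd_dist_le[OF yk, of x] xy pair_norm_minus_commute[of x y] by (simp add: d_def)
  with yk have "y \<in> nearest_pairs m n k x"
    by (simp add: nearest_pairs_def d_def)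
  then show ?thesis
    unfolding k_def by blast
qed


section \<open>Numerical GCDs close to a given pair\<close>

text \<open>A pair of GCD degree larger than \<open>k\<close> is at least \<open>\<delta>\<close> away from \<open>a\<close>, so at least \<open>\<delta> / 2\<close> away
  from \<open>x\<close>, while \<open>a\<close> itself is a pair of GCD degree \<open>k\<close> within \<open>\<epsilon>\<close> of \<open>x\<close>.\<close>

lemma num_gcd_degree_near:
  assumes a: "a \<in> gcd_deg_pairs m n k"
    and \<delta>: "\<And>y. y \<in> deg_pairs m n \<Longrightarrow> pair_norm (y - a) < \<delta> \<Longrightarrow> degree (pair_gcd y) \<le> k"
    and x: "x \<in> deg_pairs m n" "pair_norm (x - a) < \<epsilon>" and "\<epsilon> \<le> \<delta> / 2"
  shows "num_gcd_degree m n \<epsilon> x = k"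
proof -
  have "\<epsilon> > 0"
    using x(2) pair_norm_nonneg[of "x - a"] by linarith
  note props = num_gcd_degree_properties[OF x(1) this]
  have "k \<le> min m n"
    using a degree_pair_gcd_le[of a m n] by (auto simp: gcd_deg_pairs_iff)
  moreover have "gcd_dist m n k x < \<epsilon>"
    using gcd_dist_le[OF a, of x] x(2) by linarith
  ultimately have "k \<le> num_gcd_degree m n \<epsilon> x"
    by (rule props(3))
  moreover have "\<not> num_gcd_degree m n \<epsilon> x > k"
  proof
    assume *: "num_gcd_degree m n \<epsilon> x > k"
    have "\<epsilon> \<le> gcd_dist m n (num_gcd_degree m n \<epsilon> x) x"
    proof (rule gcd_dist_ge[OF props(1)])
      fix y assume "y \<in> gcd_deg_pairs m n (num_gcd_degree m n \<epsilon> x)"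
      then have "\<delta> \<le> pair_norm (y - a)"
        using \<delta>[of y] * by (fastforce simp: gcd_deg_pairs_iff)
      then show "\<epsilon> \<le> pair_norm (x - y)"
        using pair_norm_diff_triangle[of y a x] pair_norm_minus_commute[of x y] x(2) \<open>\<epsilon> \<le> \<delta> / 2\<close>
        by linarith
    qed
    with props(2) show False by simp
  qed
  ultimately show ?thesis by simp
qed

lemma nearest_gcds_near:
  assumes a: "a \<in> gcd_deg_pairs m n k" and "\<eta> > 0"
  shows "\<exists>\<delta>>0. \<forall>x. pair_norm (x - a) < \<delta> \<longrightarrow>
    (\<forall>y\<in>nearest_pairs m n k x. poly_norm (pair_gcd y - pair_gcd a) < \<eta>)"
proof -
  have "\<exists>\<delta>>0. \<forall>x\<in>UNIV. pair_norm (x - a) < \<delta> \<longrightarrow>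
    (\<forall>y\<in>nearest_pairs m n k x. poly_norm (pair_gcd y - pair_gcd a) < \<eta>)"
  proof (rule near_by_sequences, rule ccontr)
    fix X :: "nat \<Rightarrow> complex poly \<times> complex poly"
    assume X: "(\<lambda>i. pair_norm (X i - a)) \<longlonglongrightarrow> 0"
      and "\<not> (\<exists>i. \<forall>y\<in>nearest_pairs m n k (X i). poly_norm (pair_gcd y - pair_gcd a) < \<eta>)"
    then obtain Y where Y: "\<And>i. Y i \<in> nearest_pairs m n k (X i)"
      and far: "\<And>i. \<not> poly_norm (pair_gcd (Y i) - pair_gcd a) < \<eta>"
      by metis
    have Y': "Y i \<in> gcd_deg_pairs m n k" for i
      using Y[of i] by (simp add: nearest_pairs_def)
    have "coeffs_tendsto (\<lambda>i. pair_gcd (Y i) - pair_gcd a) (pair_gcd a - pair_gcd a)"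
      by (intro coeffs_tendsto_diff coeffs_tendsto_const
          gcd_cofactors_tendsto(1)[OF a Y' nearest_pairs_tendsto[OF a Y X]])
    moreover have "degree (pair_gcd (Y i) - pair_gcd a) \<le> k" for i
      using Y'[of i] a by (intro degree_diff_le) (simp_all add: gcd_deg_pairs_iff)
    ultimately have "(\<lambda>i. poly_norm (pair_gcd (Y i) - pair_gcd a)) \<longlonglongrightarrow> poly_norm (pair_gcd a - pair_gcd a)"
      by (rule tendsto_poly_norm)
    then have "\<forall>\<^sub>F i in sequentially. poly_norm (pair_gcd (Y i) - pair_gcd a) < \<eta>"
      using \<open>\<eta> > 0\<close> by (intro order_tendstoD) auto
    with far show False by simp
  qed
  then show ?thesis by simp
qed

lemma cmod_lead_coeff_near:
  assumes "a \<in> deg_pairs m n" "x \<in> deg_pairs m n"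
  shows "cmod (lead_coeff (fst a)) \<le> cmod (lead_coeff (fst x)) + pair_norm (x - a)"
    and "cmod (lead_coeff (snd a)) \<le> cmod (lead_coeff (snd x)) + pair_norm (x - a)"
proof -
  have "cmod (coeff (fst x) m - coeff (fst a) m) \<le> pair_norm (x - a)"
    "cmod (coeff (snd x) n - coeff (snd a) n) \<le> pair_norm (x - a)"
    using cmod_coeff_le_poly_norm[of "fst (x - a)" m] cmod_coeff_le_poly_norm[of "snd (x - a)" n]
      poly_norm_le_pair_norm[of "x - a"] by simp_all
  then show "cmod (lead_coeff (fst a)) \<le> cmod (lead_coeff (fst x)) + pair_norm (x - a)"
    and "cmod (lead_coeff (snd a)) \<le> cmod (lead_coeff (snd x)) + pair_norm (x - a)"
    using norm_triangle_ineq3[of "coeff (fst x) m" "coeff (fst a) m"]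
      norm_triangle_ineq3[of "coeff (snd x) n" "coeff (snd a) n"] assms
    by (simp_all add: deg_pairs_def abs_le_iff)
qed

theorem theorem5p5:
  fixes m n k :: nat and a :: "complex poly \<times> complex poly"
  assumes "a \<in> gcd_deg_pairs m n k"
  shows "\<exists>\<theta>>0.
    (\<exists>\<delta>>0. \<forall>x \<in> deg_pairs m n. pair_norm (x - a) < \<delta> \<longrightarrow>
       (\<forall>\<epsilon>. 0 < \<epsilon> \<and> \<epsilon> < \<theta> \<longrightarrow> num_gcds m n \<epsilon> x \<noteq> {})) \<and>
    (\<forall>\<epsilon>. 0 < \<epsilon> \<and> \<epsilon> < \<theta> \<longrightarrow>
       (\<exists>\<delta>>0. \<forall>x \<in> deg_pairs m n. pair_norm (x - a) < \<delta> \<longrightarrow>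
          num_gcds m n \<epsilon> x \<noteq> {} \<and>
          (\<forall>u \<in> num_gcds m n \<epsilon> x. \<forall>v \<in> num_gcds m n \<epsilon> x. poly_sim u v) \<and>
          (\<forall>u \<in> num_gcds m n \<epsilon> x. degree u = k)) \<and>
       class_limit (deg_pairs m n) (num_gcds m n \<epsilon>) a (exact_gcds a) \<and>
       num_gcds m n \<epsilon> a = exact_gcds a)"
proof -
  have a: "a \<in> deg_pairs m n"
    using assms by (simp add: gcd_deg_pairs_iff)
  define \<mu> where "\<mu> = min (cmod (lead_coeff (fst a))) (cmod (lead_coeff (snd a)))"
  have "\<mu> > 0"
    using a by (auto simp: \<mu>_def deg_pairs_def)
  obtain \<delta>0 where \<delta>0: "\<delta>0 > 0"
    "\<And>y. y \<in> deg_pairs m n \<Longrightarrow> pair_norm (y - a) < \<delta>0 \<Longrightarrow> degree (pair_gcd y) \<le> k"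
    using gcd_degree_le_near[OF assms] by blast
  obtain \<delta>1 where \<delta>1: "\<delta>1 > 0" "\<And>x y z. x \<in> deg_pairs m n \<Longrightarrow> pair_norm (x - a) < \<delta>1 \<Longrightarrow>
      y \<in> nearest_pairs m n k x \<Longrightarrow> z \<in> nearest_pairs m n k x \<Longrightarrow> y = z"
    using nearest_pair_unique_near[OF assms] by metis
  \<comment> \<open>\<open>\<delta>0 / 2\<close> keeps the numerical GCD degree equal to \<open>k\<close>; the half of \<open>\<mu>\<close> leaves room for the
    leading coefficients of \<open>x\<close> to differ from those of \<open>a\<close> by up to the other half.\<close>
  define \<theta> where "\<theta> = min (\<delta>0 / 2) (\<mu> / 2)"
  have "\<theta> > 0"
    using \<open>\<delta>0 > 0\<close> \<open>\<mu> > 0\<close> by (simp add: \<theta>_def)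
  have nonempty: "nearest_pairs m n (num_gcd_degree m n \<epsilon> x) x \<noteq> {}"
    if "x \<in> deg_pairs m n" "pair_norm (x - a) < \<mu> / 2" "0 < \<epsilon>" "\<epsilon> < \<theta>" for x \<epsilon>
    using cmod_lead_coeff_near[OF a that(1)] that
    by (intro nearest_pairs_nonempty) (auto simp: \<theta>_def \<mu>_def)
  have gcds_nonempty: "num_gcds m n \<epsilon> x \<noteq> {}"
    if x: "x \<in> deg_pairs m n" "pair_norm (x - a) < \<mu> / 2" "0 < \<epsilon>" "\<epsilon> < \<theta>" for x \<epsilon>
  proof -
    obtain y where "y \<in> nearest_pairs m n (num_gcd_degree m n \<epsilon> x) x"
      using nonempty[OF x] by blast
    then have "smult 1 (pair_gcd y) \<in> num_gcds m n \<epsilon> x"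
      unfolding num_gcds_eq using one_neq_zero by blast
    then show ?thesis by blast
  qed
  have degree_eq: "num_gcd_degree m n \<epsilon> x = k"
    if "x \<in> deg_pairs m n" "pair_norm (x - a) < \<epsilon>" "\<epsilon> < \<theta>" for x \<epsilon>
    using \<delta>0 that by (intro num_gcd_degree_near[OF assms, of \<delta>0]) (auto simp: \<theta>_def)

  have unique: "(\<exists>\<delta>>0. \<forall>x \<in> deg_pairs m n. pair_norm (x - a) < \<delta> \<longrightarrow>
          num_gcds m n \<epsilon> x \<noteq> {} \<and>
          (\<forall>u \<in> num_gcds m n \<epsilon> x. \<forall>v \<in> num_gcds m n \<epsilon> x. poly_sim u v) \<and>
          (\<forall>u \<in> num_gcds m n \<epsilon> x. degree u = k))" if \<epsilon>: "0 < \<epsilon>" "\<epsilon> < \<theta>" for \<epsilon>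
  proof (intro exI[of _ "min \<epsilon> (min (\<mu> / 2) \<delta>1)"] conjI ballI impI)
    show "min \<epsilon> (min (\<mu> / 2) \<delta>1) > 0"
      using \<epsilon> \<open>\<mu> > 0\<close> \<open>\<delta>1 > 0\<close> by simp
    fix x assume x: "x \<in> deg_pairs m n" "pair_norm (x - a) < min \<epsilon> (min (\<mu> / 2) \<delta>1)"
    then show "num_gcds m n \<epsilon> x \<noteq> {}"
      using gcds_nonempty \<epsilon> by simp
    have gcds: "num_gcds m n \<epsilon> x = {smult \<alpha> (pair_gcd y) | \<alpha> y. \<alpha> \<noteq> 0 \<and> y \<in> nearest_pairs m n k x}"
      using degree_eq[of x \<epsilon>] x \<epsilon> by (simp add: num_gcds_eq)
    fix u assume "u \<in> num_gcds m n \<epsilon> x"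
    then obtain y \<alpha> where y: "y \<in> nearest_pairs m n k x" "u = smult \<alpha> (pair_gcd y)" "\<alpha> \<noteq> 0"
      by (auto simp: gcds)
    then show "degree u = k"
      by (simp add: nearest_pairs_def gcd_deg_pairs_iff)
    fix v assume "v \<in> num_gcds m n \<epsilon> x"
    then obtain z \<beta> where z: "z \<in> nearest_pairs m n k x" "v = smult \<beta> (pair_gcd z)" "\<beta> \<noteq> 0"
      by (auto simp: gcds)
    have "y = z"
      using \<delta>1(2) x y(1) z(1) by simp
    then show "poly_sim u v"
      using y z by (auto simp: poly_sim_def intro!: exI[of _ "\<alpha> / \<beta>"])
  qed

  have limit: "class_limit (deg_pairs m n) (num_gcds m n \<epsilon>) a (exact_gcds a)" if \<epsilon>: "0 < \<epsilon>" "\<epsilon> < \<theta>" for \<epsilon>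
    unfolding class_limit_def
  proof
    fix v assume "v \<in> exact_gcds a"
    then obtain \<alpha> where \<alpha>: "v = smult \<alpha> (pair_gcd a)" "\<alpha> \<noteq> 0"
      by (auto simp: exact_gcds_eq[OF a])
    define f where "f x = (SOME y. y \<in> nearest_pairs m n k x)" for x
    define U where "U x = smult \<alpha> (pair_gcd (f x))" for x
    have f: "f x \<in> nearest_pairs m n k x"
      if "x \<in> deg_pairs m n" "pair_norm (x - a) < min \<epsilon> (\<mu> / 2)" for x
      unfolding f_def using nonempty[of x \<epsilon>] degree_eq[of x \<epsilon>] that \<epsilon> by (simp add: some_in_eq)
    have "\<exists>\<delta>>0. \<forall>x\<in>deg_pairs m n. pair_norm (x - a) < \<delta> \<longrightarrow>
        U x \<in> num_gcds m n \<epsilon> x \<and> poly_norm (U x - v) < \<eta>" if "\<eta> > 0" for \<eta>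
    proof -
      have "\<eta> / cmod \<alpha> > 0"
        using \<open>\<eta> > 0\<close> \<open>\<alpha> \<noteq> 0\<close> by simp
      then obtain \<delta> where \<delta>: "\<delta> > 0" "\<And>x y. pair_norm (x - a) < \<delta> \<Longrightarrow> y \<in> nearest_pairs m n k x \<Longrightarrow>
          poly_norm (pair_gcd y - pair_gcd a) < \<eta> / cmod \<alpha>"
        using nearest_gcds_near[OF assms] by blast
      show ?thesis
      proof (intro exI[of _ "min \<delta> (min \<epsilon> (\<mu> / 2))"] conjI ballI impI)
        show "min \<delta> (min \<epsilon> (\<mu> / 2)) > 0"
          using \<delta>(1) \<epsilon> \<open>\<mu> > 0\<close> by simp
        fix x assume x: "x \<in> deg_pairs m n" "pair_norm (x - a) < min \<delta> (min \<epsilon> (\<mu> / 2))"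
        have fx: "f x \<in> nearest_pairs m n k x"
          using f x by simp
        have "num_gcd_degree m n \<epsilon> x = k"
          using degree_eq x \<epsilon> by simp
        then show "U x \<in> num_gcds m n \<epsilon> x"
          unfolding num_gcds_eq U_def using fx \<open>\<alpha> \<noteq> 0\<close> by blast
        have "poly_norm (U x - v) = cmod \<alpha> * poly_norm (pair_gcd (f x) - pair_gcd a)"
          by (simp add: U_def \<alpha>(1) flip: smult_diff_right poly_norm_smult)
        also have "\<dots> < \<eta>"
          using \<delta>(2)[OF _ fx] x(2) \<open>\<alpha> \<noteq> 0\<close> by (simp add: field_simps)
        finally show "poly_norm (U x - v) < \<eta>" .
      qed
    qed
    then show "\<exists>U. \<forall>\<eta>>0. \<exists>\<delta>>0. \<forall>x\<in>deg_pairs m n. pair_norm (x - a) < \<delta> \<longrightarrow>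
        U x \<in> num_gcds m n \<epsilon> x \<and> poly_norm (U x - v) < \<eta>"
      by (intro exI[of _ U] allI impI)
  qed

  have exact: "num_gcds m n \<epsilon> a = exact_gcds a" if "0 < \<epsilon>" "\<epsilon> < \<theta>" for \<epsilon>
  proof -
    have "num_gcd_degree m n \<epsilon> a = k"
      using degree_eq[OF a, of \<epsilon>] that by simp
    moreover have "nearest_pairs m n k a = {a}"
      using assms by (auto simp: nearest_pairs_def gcd_dist_self[OF assms])
    ultimately show ?thesis
      unfolding num_gcds_eq exact_gcds_eq[OF a] by fastforce
  qed

  have exist: "\<exists>\<delta>>0. \<forall>x \<in> deg_pairs m n. pair_norm (x - a) < \<delta> \<longrightarrow>
       (\<forall>\<epsilon>. 0 < \<epsilon> \<and> \<epsilon> < \<theta> \<longrightarrow> num_gcds m n \<epsilon> x \<noteq> {})"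
    using gcds_nonempty \<open>\<mu> > 0\<close> by (intro exI[of _ "\<mu> / 2"]) auto
  show ?thesis
  proof (rule exI[of _ \<theta>], rule conjI[OF \<open>\<theta> > 0\<close> conjI[OF exist]], intro allI impI)
    fix \<epsilon> assume "0 < \<epsilon> \<and> \<epsilon> < \<theta>"
    then have \<epsilon>: "0 < \<epsilon>" "\<epsilon> < \<theta>"
      by simp_all
    show "(\<exists>\<delta>>0. \<forall>x \<in> deg_pairs m n. pair_norm (x - a) < \<delta> \<longrightarrow>
          num_gcds m n \<epsilon> x \<noteq> {} \<and>
          (\<forall>u \<in> num_gcds m n \<epsilon> x. \<forall>v \<in> num_gcds m n \<epsilon> x. poly_sim u v) \<and>
          (\<forall>u \<in> num_gcds m n \<epsilon> x. degree u = k)) \<and>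
       class_limit (deg_pairs m n) (num_gcds m n \<epsilon>) a (exact_gcds a) \<and>
       num_gcds m n \<epsilon> a = exact_gcds a"
      by (rule conjI[OF unique[OF \<epsilon>] conjI[OF limit[OF \<epsilon>] exact[OF \<epsilon>]]])
  qed
qed

end
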